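(* Let $(\mathbb{R}^n,g)$ be a pseudo-Euclidean space, $n\ge3$, with coordinates $x=(x_1,\dots,x_n)$ and $g_{ij}=\delta_{ij}\varepsilon_i$, $\varepsilon_i=\pm1$. Let $\xi=\sum_{i=1}^n\alpha_ix_i$, $\alpha_i\in\mathbb{R}$, with $\sum_{i=1}^n\varepsilon_i\alpha_i^2=\varepsilon_{i_0}\in\{1,-1\}$. Let $m\ge1$ be an integer and let $k,c_1,c_2,b$ be real constants with $k,c_1,c_2>0$. Set $N_\pm=-k\pm\sqrt{m+k^2(n-1)}$, and for either choice of sign consider $$\varphi_\pm(\xi)=\frac{c_2}{(N_\pm\xi+b)^{k/N_\pm}},\qquad f_\pm(\xi)=\frac{c_1}{(N_\pm\xi+b)^{1/N_\pm}},\qquad h_\pm(\xi)=-\frac{m-(n-2)k+N_\pm}{N_\pm}\ln(N_\pm\xi+b).$$ Then, with $\varphi=\varphi_\pm$, $f=f_\pm$, $h=h_\pm$, the warped product $M=(\mathbb{R}^n,\overline g)\times_fF^m$, with $\overline g=\frac1{\varphi^2}g$ and $F^m$ a Ricci-flat semi-Riemannian manifold of dimension $m$, is a steady gradient Ricci soliton with $h$ as potential function. These solutions are defined on the half space $N_\pm\xi+b>0$ of $\mathbb{R}^n$ (which replaces $\mathbb{R}^n$ as the base), that is, on $\sum_{i}\alpha_ix_i>-\frac{b}{-k+\sqrt{m+k^2(n-1)}}$ for the sign $+$ and on $\sum_i\alpha_ix_i<-\frac{b}{-k-\sqrt{m+k^2(n-1)}}$ for the sign $-$.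
   Context: A semi-Riemannian manifold $(M,\widetilde g)$ is a steady gradient Ricci soliton with potential function $h$ if $\mathrm{Ric}_{\widetilde g}+\mathrm{Hess}_{\widetilde g}(h)=0$. The warped product $B\times_fF$ of semi-Riemannian manifolds $(B,g_B)$, $(F,g_F)$ with warping function $f>0$ on $B$ is $B\times F$ with metric $g_B+f^2g_F$. Functions on the base are regarded as functions on $M$ via the projection. *)

theory Defs
  imports "HOL-Analysis.Analysis"
begin

section \<open>Smooth maps\<close>

primrec Ck_on :: "'a::euclidean_space set \<Rightarrow> ('a \<Rightarrow> 'b::real_normed_vector) \<Rightarrow> nat \<Rightarrow> bool" where
  "Ck_on S f 0 \<longleftrightarrow> continuous_on S f"
| "Ck_on S f (Suc r) \<longleftrightarrow>
     (\<forall>x\<in>S. f differentiable (at x)) \<and>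
     (\<forall>v. Ck_on S (\<lambda>x. frechet_derivative f (at x) v) r)"

text \<open>Only meant for open \<open>S\<close>.\<close>
definition smooth_on :: "'a::euclidean_space set \<Rightarrow> ('a \<Rightarrow> 'b::real_normed_vector) \<Rightarrow> bool" where
  "smooth_on S f \<longleftrightarrow> (\<forall>r. Ck_on S f r)"

definition partial :: "'d \<Rightarrow> (real^'d::finite \<Rightarrow> real) \<Rightarrow> real^'d \<Rightarrow> real" where
  "partial a u y = frechet_derivative u (at y) (axis a 1)"


section \<open>Semi-Riemannian manifolds\<close>

definition diag_matrix :: "('d \<Rightarrow> real) \<Rightarrow> real^'d::finite^'d" where
  "diag_matrix \<eta> = (\<chi> a b. if a = b then \<eta> a else 0)"

text \<open>
  The index of a scalar product with Gram matrix \<open>A\<close>: there is an orthonormal basis (the columns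
  of \<open>P\<close>) having exactly \<open>\<nu>\<close> timelike vectors.
\<close>
definition has_index :: "real^'d::finite^'d \<Rightarrow> nat \<Rightarrow> bool" where
  "has_index A \<nu> \<longleftrightarrow>
     (\<exists>(P :: real^'d^'d) \<eta>. invertible P \<and> (\<forall>a. \<eta> a = 1 \<or> \<eta> a = -1) \<and>
        transpose P ** A ** P = diag_matrix \<eta> \<and> card {a. \<eta> a = -1} = \<nu>)"

text \<open>
  A manifold modelled on \<open>real^'d\<close> is a topological space with an indexed atlas; a (0,2)-tensor
  field is given by its component matrices: \<open>metric M i p\<close> is the Gram matrix at the point \<open>p\<close>
  of the coordinate vector fields of chart \<open>i\<close>.
\<close>
record ('p, 'i, 'd) charted_metric_space =
  mtop :: "'p topology"
  atlas :: "'i set"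
  chart_dom :: "'i \<Rightarrow> 'p set"
  chart :: "'i \<Rightarrow> 'p \<Rightarrow> real^'d"
  metric :: "'i \<Rightarrow> 'p \<Rightarrow> real^'d^'d"

definition chart_inv :: "('p, 'i, 'd::finite) charted_metric_space \<Rightarrow> 'i \<Rightarrow> real^'d \<Rightarrow> 'p" where
  "chart_inv M i = inv_into (chart_dom M i) (chart M i)"

definition chart_img :: "('p, 'i, 'd::finite) charted_metric_space \<Rightarrow> 'i \<Rightarrow> (real^'d) set" where
  "chart_img M i = chart M i ` chart_dom M i"

definition smooth_manifold :: "('p, 'i, 'd::finite) charted_metric_space \<Rightarrow> bool" where
  "smooth_manifold M \<longleftrightarrow>
     Hausdorff_space (mtop M) \<and> second_countable (mtop M) \<and>
     (\<Union>i\<in>atlas M. chart_dom M i) = topspace (mtop M) \<and>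
     (\<forall>i\<in>atlas M. openin (mtop M) (chart_dom M i) \<and> open (chart_img M i) \<and>
        homeomorphic_map (subtopology (mtop M) (chart_dom M i)) (top_of_set (chart_img M i))
          (chart M i)) \<and>
     (\<forall>i\<in>atlas M. \<forall>j\<in>atlas M.
        smooth_on (chart M i ` (chart_dom M i \<inter> chart_dom M j)) (chart M j \<circ> chart_inv M i))"

definition smooth_function :: "('p, 'i, 'd::finite) charted_metric_space \<Rightarrow> ('p \<Rightarrow> real) \<Rightarrow> bool" where
  "smooth_function M u \<longleftrightarrow> (\<forall>i\<in>atlas M. smooth_on (chart_img M i) (u \<circ> chart_inv M i))"

definition semi_riemannian_manifold :: "('p, 'i, 'd::finite) charted_metric_space \<Rightarrow> bool" where
  "semi_riemannian_manifold M \<longleftrightarrow>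
     smooth_manifold M \<and>
     (\<forall>i\<in>atlas M. smooth_on (chart_img M i) (metric M i \<circ> chart_inv M i)) \<and>
     (\<forall>i\<in>atlas M. \<forall>j\<in>atlas M. \<forall>p \<in> chart_dom M i \<inter> chart_dom M j.
        let J = jacobian (chart M j \<circ> chart_inv M i) (at (chart M i p))
        in metric M i p = transpose J ** metric M j p ** J) \<and>
     (\<forall>i\<in>atlas M. \<forall>p\<in>chart_dom M i.
        transpose (metric M i p) = metric M i p \<and> invertible (metric M i p)) \<and>
     (\<exists>\<nu>. \<forall>i\<in>atlas M. \<forall>p\<in>chart_dom M i. has_index (metric M i p) \<nu>)"


section \<open>Curvature\<close>

text \<open>\<open>christoffel G c a b\<close> is \<open>\<Gamma>\<close> with upper index \<open>c\<close> and lower indices \<open>a\<close>, \<open>b\<close>.\<close>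
definition christoffel ::
    "(real^'d \<Rightarrow> real^'d^'d) \<Rightarrow> 'd \<Rightarrow> 'd \<Rightarrow> 'd \<Rightarrow> real^'d::finite \<Rightarrow> real" where
  "christoffel G c a b y =
     (1/2) * (\<Sum>l\<in>UNIV. matrix_inv (G y) $ c $ l *
        (partial a (\<lambda>z. G z $ b $ l) y + partial b (\<lambda>z. G z $ a $ l) y
          - partial l (\<lambda>z. G z $ a $ b) y))"

text \<open>
  \<open>riemann G l c a b\<close> is the \<open>l\<close>-component of \<open>R(\<partial>\<^sub>a, \<partial>\<^sub>b) \<partial>\<^sub>c\<close>, where
  \<open>R(X,Y)Z = \<nabla>\<^sub>X \<nabla>\<^sub>Y Z - \<nabla>\<^sub>Y \<nabla>\<^sub>X Z - \<nabla>\<close>\<open>\<^bsub>[X,Y]\<^esub>\<close>\<open> Z\<close>.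
\<close>
definition riemann ::
    "(real^'d \<Rightarrow> real^'d^'d) \<Rightarrow> 'd \<Rightarrow> 'd \<Rightarrow> 'd \<Rightarrow> 'd \<Rightarrow> real^'d::finite \<Rightarrow> real" where
  "riemann G l c a b y =
     partial a (christoffel G l b c) y - partial b (christoffel G l a c) y
     + (\<Sum>q\<in>UNIV. christoffel G l a q y * christoffel G q b c y
                 - christoffel G l b q y * christoffel G q a c y)"

text \<open>\<open>Ric(Y,Z)\<close> is the trace of \<open>X \<mapsto> R(X,Y)Z\<close>.\<close>
definition ricci_coord :: "(real^'d \<Rightarrow> real^'d^'d) \<Rightarrow> real^'d::finite \<Rightarrow> real^'d^'d" where
  "ricci_coord G y = (\<chi> b c. \<Sum>l\<in>UNIV. riemann G l c l b y)"

definition hessian_coord ::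
    "(real^'d \<Rightarrow> real^'d^'d) \<Rightarrow> (real^'d \<Rightarrow> real) \<Rightarrow> real^'d::finite \<Rightarrow> real^'d^'d" where
  "hessian_coord G u y =
     (\<chi> a b. partial a (partial b u) y - (\<Sum>c\<in>UNIV. christoffel G c a b y * partial c u y))"

definition ricci :: "('p, 'i, 'd::finite) charted_metric_space \<Rightarrow> 'i \<Rightarrow> 'p \<Rightarrow> real^'d^'d" where
  "ricci M i p = ricci_coord (metric M i \<circ> chart_inv M i) (chart M i p)"

definition hessian ::
    "('p, 'i, 'd::finite) charted_metric_space \<Rightarrow> ('p \<Rightarrow> real) \<Rightarrow> 'i \<Rightarrow> 'p \<Rightarrow> real^'d^'d" where
  "hessian M u i p = hessian_coord (metric M i \<circ> chart_inv M i) (u \<circ> chart_inv M i) (chart M i p)"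

definition ricci_flat :: "('p, 'i, 'd::finite) charted_metric_space \<Rightarrow> bool" where
  "ricci_flat M \<longleftrightarrow> (\<forall>i\<in>atlas M. \<forall>p\<in>chart_dom M i. ricci M i p = 0)"

definition steady_gradient_ricci_soliton ::
    "('p, 'i, 'd::finite) charted_metric_space \<Rightarrow> ('p \<Rightarrow> real) \<Rightarrow> bool" where
  "steady_gradient_ricci_soliton M u \<longleftrightarrow>
     semi_riemannian_manifold M \<and> smooth_function M u \<and>
     (\<forall>i\<in>atlas M. \<forall>p\<in>chart_dom M i. ricci M i p + hessian M u i p = 0)"


section \<open>Constructions\<close>

text \<open>The open set \<open>W\<close> of \<open>real^'n\<close>, with the identity as single chart and
  metric \<open>g\<^sub>i\<^sub>j = \<delta>\<^sub>i\<^sub>j \<epsilon>\<^sub>i\<close>.\<close>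
definition pseudo_euclidean ::
    "('n::finite \<Rightarrow> real) \<Rightarrow> (real^'n) set \<Rightarrow> (real^'n, unit, 'n) charted_metric_space" where
  "pseudo_euclidean \<epsilon> W =
     \<lparr> mtop = top_of_set W, atlas = UNIV, chart_dom = (\<lambda>_. W), chart = (\<lambda>_ x. x),
       metric = (\<lambda>_ _. diag_matrix \<epsilon>) \<rparr>"

definition conformal_metric ::
    "('p \<Rightarrow> real) \<Rightarrow> ('p, 'i, 'd::finite) charted_metric_space \<Rightarrow> ('p, 'i, 'd) charted_metric_space" where
  "conformal_metric w M = M\<lparr> metric := (\<lambda>i p. w p *\<^sub>R metric M i p) \<rparr>"

definition join_vec :: "real^'n::finite \<Rightarrow> real^'m::finite \<Rightarrow> real^('n + 'm)" where
  "join_vec x y = (\<chi> s. case s of Inl a \<Rightarrow> x $ a | Inr b \<Rightarrow> y $ b)"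

definition block_diag :: "real^'n::finite^'n \<Rightarrow> real^'m::finite^'m \<Rightarrow> real^('n + 'm)^('n + 'm)" where
  "block_diag A B =
     (\<chi> s t. case (s, t) of (Inl a, Inl a') \<Rightarrow> A $ a $ a' | (Inr b, Inr b') \<Rightarrow> B $ b $ b' | _ \<Rightarrow> 0)"

definition warping_function :: "('p, 'i, 'd::finite) charted_metric_space \<Rightarrow> ('p \<Rightarrow> real) \<Rightarrow> bool" where
  "warping_function B f \<longleftrightarrow> smooth_function B f \<and> (\<forall>p\<in>topspace (mtop B). f p > 0)"

definition warped_product ::
    "('p, 'i, 'n::finite) charted_metric_space \<Rightarrow> ('p \<Rightarrow> real) \<Rightarrow>
     ('q, 'j, 'm::finite) charted_metric_space \<Rightarrow> ('p \<times> 'q, 'i \<times> 'j, 'n + 'm) charted_metric_space" where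
  "warped_product B f F =
     \<lparr> mtop = prod_topology (mtop B) (mtop F),
       atlas = atlas B \<times> atlas F,
       chart_dom = (\<lambda>(i, j). chart_dom B i \<times> chart_dom F j),
       chart = (\<lambda>(i, j) (p, q). join_vec (chart B i p) (chart F j q)),
       metric = (\<lambda>(i, j) (p, q). block_diag (metric B i p) ((f p)\<^sup>2 *\<^sub>R metric F j q)) \<rparr>"

end

(* Write u = N xi + b > 0. The base metric phi^-2 g has conformal factor proportional to u^(2k/N)
   and f^2 is proportional to u^(-2/N), so their logarithmic differentials along x_i are
   2k alpha_i / u and -2 alpha_i / u. In product charts every Christoffel symbol is therefore a
   function of u times a function of the fiber coordinates, and the Ricci tensor and the Hessian of h
   can be computed directly. The coefficients of g_ij and of the fiber metric in Ric + Hess h cancel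
   because h' = -(m - (n-2)k + N)/u, and the coefficient of alpha_i alpha_j is
   N^2 + 2kN - m - k^2 (n-2), which vanishes because N + k is a square root of m + k^2 (n-1). *)

theory Submission
  imports Defs
begin

section \<open>Calculus of smooth maps\<close>

text \<open>The potential offers one free constant, H in h' = -H/u, but two metric coefficients have
  to vanish. This works because, up to common factors, the Ricci tensor has the coefficients k H0
  and -H0 on the base and the fiber metric with the same H0 = m - (n-2)k + N, while the Hessian
  contributes -k H and H; so H = H0 removes both. The curvature computation knows N only through N
  \<noteq> 0 and its quadratic equation, and knows the two conformal factors only through their
  differential equations, so both signs and all constants are treated together. Two obstacles shape
  the proof. The fiber comes with an arbitrary atlas, so its Christoffel symbols are carried along
  unevaluated; they must be known to be differentiable, and Ricci flatness is invoked once, at the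
  end. Inverse charts have arbitrary values outside the chart image, so coordinate formulas hold on
  open sets only, and derivatives are transferred between functions that agree near a point.\<close>

lemma Ck_on_cong_imp:
  assumes "open S" "\<And>x. x \<in> S \<Longrightarrow> f x = g x" "Ck_on S f r"
  shows "Ck_on S g r"
  using assms(2,3)
proof (induction r arbitrary: f g)
  case 0
  then show ?case by (simp cong: continuous_on_cong)
next
  case (Suc r)
  have d: "f differentiable (at x)" if "x \<in> S" for x
    using Suc.prems that by simp
  have "g differentiable (at x)" if "x \<in> S" for x
    using d[OF that] has_derivative_transform_within_open[OF _ \<open>open S\<close> that] Suc.prems(1)
    unfolding differentiable_def by metis
  moreover have "Ck_on S (\<lambda>x. frechet_derivative g (at x) v) r" for v
  proof (rule Suc.IH)
    show "Ck_on S (\<lambda>x. frechet_derivative f (at x) v) r" using Suc.prems by simp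
    show "frechet_derivative f (at x) v = frechet_derivative g (at x) v" if "x \<in> S" for x
      using frechet_derivative_transform_within_open[OF d[OF that] \<open>open S\<close> that Suc.prems(1)]
      by simp
  qed
  ultimately show ?case by simp
qed

text \<open>\<open>frechet_derivative\<close> is a choice operator. With this rule an induction on
  the order can work with an explicit derivative \<open>D\<close>, of which only the directional
  derivatives have to be treated.\<close>

lemma Ck_on_Suc_intro:
  assumes S: "open S" and d: "\<And>x. x \<in> S \<Longrightarrow> (f has_derivative D x) (at x)"
    and c: "\<And>v. Ck_on S (\<lambda>x. D x v) r"
  shows "Ck_on S f (Suc r)"
proof -
  have "Ck_on S (\<lambda>x. frechet_derivative f (at x) v) r" for v
    by (rule Ck_on_cong_imp[OF S _ c[of v]]) (metis d frechet_derivative_at)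
  then show ?thesis using d by (auto simp: differentiable_def)
qed

lemma Ck_on_has_derivative:
  assumes "Ck_on S f (Suc r)" "x \<in> S"
  shows "(f has_derivative frechet_derivative f (at x)) (at x)"
  using assms by (simp add: frechet_derivative_works[symmetric])

text \<open>The product rule leaves one factor undifferentiated: it is known at order
  \<open>Suc r\<close> but needed at order \<open>r\<close>.\<close>

lemma Ck_on_pred:
  assumes "Ck_on S f (Suc r)"
  shows "Ck_on S f r"
  using assms
proof (induction r arbitrary: f)
  case 0
  then show ?case
    by (auto intro!: continuous_at_imp_continuous_on differentiable_imp_continuous_within)
next
  case (Suc r)
  then show ?case by (metis Ck_on.simps(2))
qed

lemma Ck_on_const: "open S \<Longrightarrow> Ck_on S (\<lambda>x. c) r"
  by (induction r arbitrary: c) auto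

lemma Ck_on_bounded_linear:
  assumes "open S" "bounded_linear L"
  shows "Ck_on S L r"
proof (cases r)
  case 0
  then show ?thesis using assms by (simp add: linear_continuous_on)
next
  case (Suc r')
  show ?thesis unfolding Suc
    by (rule Ck_on_Suc_intro[where D="\<lambda>_. L"])
      (use assms in \<open>auto intro: bounded_linear_imp_has_derivative Ck_on_const\<close>)
qed

lemma Ck_on_add:
  assumes S: "open S" and "Ck_on S f r" "Ck_on S g r"
  shows "Ck_on S (\<lambda>x. f x + g x) r"
  using assms(2,3)
proof (induction r arbitrary: f g)
  case 0
  then show ?case by (simp add: continuous_on_add)
next
  case (Suc r)
  show ?case
    by (rule Ck_on_Suc_intro[OF S has_derivative_add[OF Ck_on_has_derivative Ck_on_has_derivative]])
      (use Suc in auto)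
qed

lemma Ck_on_linear_compose:
  assumes S: "open S" and L: "bounded_linear L" and "Ck_on S f r"
  shows "Ck_on S (\<lambda>x. L (f x)) r"
  using assms(3)
proof (induction r arbitrary: f)
  case 0
  then show ?case by (simp add: L bounded_linear.continuous_on)
next
  case (Suc r)
  show ?case
    by (rule Ck_on_Suc_intro[OF S bounded_linear.has_derivative[OF L Ck_on_has_derivative]])
      (use Suc in auto)
qed

text \<open>A directional derivative is a sum of two terms of the same bilinear shape with other
  factors, so the induction keeps \<open>f\<close> and \<open>g\<close> arbitrary. The instances in
  use are multiplication of reals and scaling of vectors and matrices.\<close>

lemma Ck_on_bilinear:
  assumes S: "open S" and B: "bounded_bilinear B" and "Ck_on S f r" "Ck_on S g r"
  shows "Ck_on S (\<lambda>x. B (f x) (g x)) r"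
  using assms(3,4)
proof (induction r arbitrary: f g)
  case 0
  then show ?case by (simp add: B bounded_bilinear.continuous_on)
next
  case (Suc r)
  show ?case
  proof (rule Ck_on_Suc_intro[OF S bounded_bilinear.FDERIV[OF B Ck_on_has_derivative Ck_on_has_derivative]])
    fix v
    have "Ck_on S f r" "Ck_on S g r" using Suc.prems Ck_on_pred by blast+
    then show "Ck_on S (\<lambda>x. B (f x) (frechet_derivative g (at x) v) +
        B (frechet_derivative f (at x) v) (g x)) r"
      using Suc by (intro Ck_on_add[OF S] Suc.IH) auto
  qed (use Suc in auto)
qed

text \<open>With a linear inner map, the derivative in direction v is the derivative of
  \<open>f\<close> in the fixed direction \<open>L v\<close>, again composed with \<open>L\<close>,
  so the induction closes. With a projection as \<open>L\<close>, functions on one factor become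
  functions on the product.\<close>

lemma Ck_on_compose_linear:
  fixes L :: "'a::euclidean_space \<Rightarrow> 'b::euclidean_space"
  assumes S: "open S" and L: "bounded_linear L" and LS: "L ` S \<subseteq> T" and "Ck_on T f r"
  shows "Ck_on S (\<lambda>x. f (L x)) r"
  using assms(4)
proof (induction r arbitrary: f)
  case 0
  then show ?case
    using L LS by (auto intro: continuous_on_compose2 linear_continuous_on)
next
  case (Suc r)
  have "((\<lambda>x. f (L x)) has_derivative (\<lambda>v. frechet_derivative f (at (L x)) (L v))) (at x)"
    if "x \<in> S" for x
  proof -
    have "L x \<in> T" using that LS by auto
    from Ck_on_has_derivative[OF Suc.prems this]
    show ?thesis
      using has_derivative_compose[OF bounded_linear_imp_has_derivative[OF L]] by blast
  qed
  then show ?case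
    by (rule Ck_on_Suc_intro[OF S]) (use Suc in auto)
qed

text \<open>Each derivative lowers the exponent by one, hence \<open>p\<close> stays arbitrary in
  the induction.\<close>

lemma Ck_on_powr:
  fixes L :: "'a::euclidean_space \<Rightarrow> real"
  assumes S: "open S" and L: "bounded_linear L" and pos: "\<And>x. x \<in> S \<Longrightarrow> L x + b > 0"
  shows "Ck_on S (\<lambda>x. (L x + b) powr p) r"
proof (induction r arbitrary: p)
  case 0
  show ?case
    proof -
    have c: "continuous_on S (\<lambda>x. L x + b)"
      by (intro continuous_on_add linear_continuous_on[OF L] continuous_on_const)
    have "L x + b \<noteq> 0" if "x \<in> S" for x using pos[OF that] by simp
    then show ?thesis
      using c by (auto intro!: continuous_on_powr continuous_on_ln)
  qed
next
  case (Suc r)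
  have "((\<lambda>x. (L x + b) powr p) has_derivative (\<lambda>v. (p * L v) * (L x + b) powr (p - 1))) (at x)"
    if "x \<in> S" for x
  proof -
    have "((\<lambda>x. L x + b) has_derivative L) (at x)"
      using has_derivative_add[OF bounded_linear_imp_has_derivative[OF L] has_derivative_const, of b] by simp
    moreover have "((\<lambda>t. t powr p) has_derivative (*) (p * (L x + b) powr (p - 1))) (at (L x + b))"
      using has_real_derivative_powr[of "L x + b" p] pos[OF that]
      by (simp add: has_field_derivative_def)
    ultimately show ?thesis
      by (rule has_derivative_eq_rhs[OF has_derivative_compose]) (simp add: fun_eq_iff)
  qed
  then show ?case
    by (rule Ck_on_Suc_intro[OF S])
      (assumption, intro Ck_on_bilinear[OF S bounded_bilinear_mult] Suc.IH Ck_on_const[OF S])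
qed

text \<open>One differentiation produces the power with exponent -1, and the case of powers finishes
  the proof.\<close>

lemma Ck_on_ln:
  fixes L :: "'a::euclidean_space \<Rightarrow> real"
  assumes S: "open S" and L: "bounded_linear L" and pos: "\<And>x. x \<in> S \<Longrightarrow> L x + b > 0"
  shows "Ck_on S (\<lambda>x. ln (L x + b)) r"
proof (cases r)
  case 0
  show ?thesis
    proof -
    have c: "continuous_on S (\<lambda>x. L x + b)"
      by (intro continuous_on_add linear_continuous_on[OF L] continuous_on_const)
    have "L x + b \<noteq> 0" if "x \<in> S" for x using pos[OF that] by simp
    then show ?thesis
      using c 0 by (auto intro!: continuous_on_powr continuous_on_ln)
  qed
next
  case (Suc r')
  have "((\<lambda>x. ln (L x + b)) has_derivative (\<lambda>v. L v * (L x + b) powr (-1))) (at x)"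
    if "x \<in> S" for x
  proof -
    have "((\<lambda>x. L x + b) has_derivative L) (at x)"
      using has_derivative_add[OF bounded_linear_imp_has_derivative[OF L] has_derivative_const, of b] by simp
    moreover have "(ln has_derivative (*) (1 / (L x + b))) (at (L x + b))"
      using DERIV_ln_divide[OF pos[OF that]] pos[OF that]
      by (simp add: has_field_derivative_def)
    ultimately show ?thesis
      by (rule has_derivative_eq_rhs[OF has_derivative_compose])
        (use pos[OF that] in \<open>simp add: fun_eq_iff powr_minus_divide\<close>)
  qed
  then show ?thesis unfolding Suc
    by (rule Ck_on_Suc_intro[OF S])
      (assumption, intro Ck_on_bilinear[OF S bounded_bilinear_mult] Ck_on_powr[OF S L pos] Ck_on_const[OF S])
qed

lemma smooth_on_has_derivative:
  assumes "smooth_on S f" "x \<in> S"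
  shows "(f has_derivative frechet_derivative f (at x)) (at x)"
  using assms Ck_on_has_derivative unfolding smooth_on_def by blast

lemma smooth_on_frechet_derivative:
  assumes "smooth_on S f"
  shows "smooth_on S (\<lambda>x. frechet_derivative f (at x) v)"
  using assms unfolding smooth_on_def by (metis Ck_on.simps(2))

text \<open>On an open set, equality on \<open>S\<close> is equality near each of its points. This
  replaces functions built from \<open>chart_inv\<close> by the closed formulas that hold on the
  chart image.\<close>

lemma smooth_on_cong_imp:
  assumes "open S" "\<And>x. x \<in> S \<Longrightarrow> f x = g x" "smooth_on S f"
  shows "smooth_on S g"
  unfolding smooth_on_def
proof
  fix r
  show "Ck_on S g r"
    by (rule Ck_on_cong_imp[OF assms(1), of f]) (use assms in \<open>auto simp: smooth_on_def\<close>)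
qed

lemma smooth_on_const: "open S \<Longrightarrow> smooth_on S (\<lambda>x. c)"
  unfolding smooth_on_def by (blast intro: Ck_on_const)

lemma smooth_on_ident: "open S \<Longrightarrow> smooth_on S (\<lambda>x. x)"
  unfolding smooth_on_def by (blast intro: Ck_on_bounded_linear bounded_linear_ident)

lemma smooth_on_add:
  "open S \<Longrightarrow> smooth_on S f \<Longrightarrow> smooth_on S g \<Longrightarrow> smooth_on S (\<lambda>x. f x + g x)"
  unfolding smooth_on_def by (blast intro: Ck_on_add)

lemma smooth_on_linear_compose:
  "open S \<Longrightarrow> bounded_linear L \<Longrightarrow> smooth_on S f \<Longrightarrow> smooth_on S (\<lambda>x. L (f x))"
  unfolding smooth_on_def by (blast intro: Ck_on_linear_compose)

lemma smooth_on_bilinear: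
  "open S \<Longrightarrow> bounded_bilinear B \<Longrightarrow> smooth_on S f \<Longrightarrow> smooth_on S g \<Longrightarrow> smooth_on S (\<lambda>x. B (f x) (g x))"
  unfolding smooth_on_def by (blast intro: Ck_on_bilinear)

lemma smooth_on_compose_linear:
  fixes L :: "'a::euclidean_space \<Rightarrow> 'b::euclidean_space"
  shows "open S \<Longrightarrow> bounded_linear L \<Longrightarrow> L ` S \<subseteq> T \<Longrightarrow> smooth_on T f \<Longrightarrow> smooth_on S (\<lambda>x. f (L x))"
  unfolding smooth_on_def by (blast intro: Ck_on_compose_linear)

lemma smooth_on_powr:
  fixes L :: "'a::euclidean_space \<Rightarrow> real"
  shows "open S \<Longrightarrow> bounded_linear L \<Longrightarrow> (\<And>x. x \<in> S \<Longrightarrow> L x + b > 0) \<Longrightarrow> smooth_on S (\<lambda>x. (L x + b) powr p)"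
  unfolding smooth_on_def by (blast intro: Ck_on_powr)

lemma smooth_on_ln:
  fixes L :: "'a::euclidean_space \<Rightarrow> real"
  shows "open S \<Longrightarrow> bounded_linear L \<Longrightarrow> (\<And>x. x \<in> S \<Longrightarrow> L x + b > 0) \<Longrightarrow> smooth_on S (\<lambda>x. ln (L x + b))"
  unfolding smooth_on_def by (blast intro: Ck_on_ln)

section \<open>Block vectors and block matrices\<close>

definition proj_left :: "real^('n::finite + 'm::finite) \<Rightarrow> real^'n" where
  "proj_left y = (\<chi> a. y $ Inl a)"

definition proj_right :: "real^('n::finite + 'm::finite) \<Rightarrow> real^'m" where
  "proj_right y = (\<chi> a. y $ Inr a)"

lemma join_vec_nth [simp]:
  "join_vec x z $ Inl a = x $ a" "join_vec x z $ Inr b = z $ b"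
  by (simp_all add: join_vec_def)

lemma proj_nth [simp]: "proj_left y $ a = y $ Inl a" "proj_right y $ b = y $ Inr b"
  by (simp_all add: proj_left_def proj_right_def)

lemma vec_sum_eq_iff: "x = y \<longleftrightarrow> proj_left x = proj_left y \<and> proj_right x = proj_right y"
  unfolding vec_eq_iff by (simp add: split_sum_all)

lemma proj_join_vec [simp]: "proj_left (join_vec x z) = x" "proj_right (join_vec x z) = z"
  by (simp_all add: vec_eq_iff)

lemma join_vec_proj [simp]: "join_vec (proj_left y) (proj_right y) = y"
  by (simp add: vec_sum_eq_iff)

lemma join_vec_inject [simp]: "join_vec x z = join_vec x' z' \<longleftrightarrow> x = x' \<and> z = z'"
  by (simp add: vec_sum_eq_iff)

text \<open>A sum of two linear maps: in this form the rules for sums and linear maps give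
  continuity, smoothness and derivatives of joined maps. \<open>block_diag_split\<close> plays the
  same role for block matrices.\<close>

lemma join_vec_split: "join_vec x z = join_vec x 0 + join_vec 0 z"
  by (simp add: vec_eq_iff split_sum_all)

lemma bounded_linear_proj: "bounded_linear proj_left" "bounded_linear proj_right"
  unfolding linear_conv_bounded_linear[symmetric] by (auto intro!: linearI simp: vec_eq_iff)

lemma bounded_linear_join_vec: "bounded_linear (\<lambda>x. join_vec x 0)" "bounded_linear (join_vec 0)"
  unfolding linear_conv_bounded_linear[symmetric]
  by (auto intro!: linearI simp: vec_eq_iff split_sum_all)

lemma bounded_linear_component: "bounded_linear (\<lambda>x :: real^'n::finite. x $ i)"
  unfolding linear_conv_bounded_linear[symmetric] by (auto intro!: linearI)

lemma bounded_linear_matrix_component: "bounded_linear (\<lambda>x :: real^'n::finite^'k::finite. x $ i $ j)"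
  unfolding linear_conv_bounded_linear[symmetric] by (auto intro!: linearI)

lemma proj_axis [simp]:
  "proj_left (axis (Inl a) c) = axis a c" "proj_left (axis (Inr b) c) = 0"
  "proj_right (axis (Inr b) c) = axis b c" "proj_right (axis (Inl a) c) = 0"
  by (auto simp: vec_eq_iff axis_def)

lemma sum_UNIV_sum:
  "(\<Sum>s\<in>UNIV. g s) = (\<Sum>a\<in>UNIV. g (Inl a)) + (\<Sum>b\<in>UNIV. g (Inr b))"
  for g :: "'n::finite + 'm::finite \<Rightarrow> 'b::comm_monoid_add"
  by (subst UNIV_Plus_UNIV[symmetric], subst sum.Plus) (auto simp: o_def)

lemma block_diag_nth [simp]:
  "block_diag A B $ Inl a $ Inl a' = A $ a $ a'" "block_diag A B $ Inr b $ Inr b' = B $ b $ b'"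
  "block_diag A B $ Inl a $ Inr b' = 0" "block_diag A B $ Inr b $ Inl a' = 0"
  by (simp_all add: block_diag_def)

lemma block_diag_mult: "block_diag A B ** block_diag C D = block_diag (A ** C) (B ** D)"
  by (simp add: vec_eq_iff split_sum_all matrix_matrix_mult_def sum_UNIV_sum)

lemma transpose_block_diag: "transpose (block_diag A B) = block_diag (transpose A) (transpose B)"
  by (simp add: vec_eq_iff split_sum_all transpose_def)

lemma block_diag_mat: "block_diag (mat c) (mat c) = mat c"
  by (simp add: vec_eq_iff split_sum_all mat_def)

lemma block_diag_split: "block_diag A B = block_diag A 0 + block_diag 0 B"
  by (simp add: vec_eq_iff split_sum_all)

lemma bounded_linear_block_diag: "bounded_linear (\<lambda>A. block_diag A 0)" "bounded_linear (block_diag 0)"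
  unfolding linear_conv_bounded_linear[symmetric]
  by (auto intro!: linearI simp: vec_eq_iff split_sum_all)

section \<open>Inverses, scaling and index of block matrices\<close>

lemma matrix_inv_eqI:
  fixes A :: "real^'n::finite^'n"
  assumes "A ** B = mat 1"
  shows "matrix_inv A = B"
proof -
  have BA: "B ** A = mat 1" using assms matrix_left_right_inverse by blast
  have "A ** matrix_inv A = mat 1 \<and> matrix_inv A ** A = mat 1"
    unfolding matrix_inv_def by (rule someI[of _ B]) (use assms BA in simp)
  then show ?thesis
    by (metis BA matrix_mul_assoc matrix_mul_lid matrix_mul_rid)
qed

lemma matrix_inv_mult:
  fixes A :: "real^'n::finite^'n"
  assumes "invertible A"
  shows "A ** matrix_inv A = mat 1" "matrix_inv A ** A = mat 1"
proof -
  obtain B where "A ** B = mat 1" using assms by (auto simp: invertible_def)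
  then show "A ** matrix_inv A = mat 1" using matrix_inv_eqI by metis
  then show "matrix_inv A ** A = mat 1" using matrix_left_right_inverse by blast
qed

lemma matrix_inv_block_diag:
  assumes "invertible A" "invertible B"
  shows "matrix_inv (block_diag A B) = block_diag (matrix_inv A) (matrix_inv B)"
  by (rule matrix_inv_eqI) (simp add: block_diag_mult matrix_inv_mult assms block_diag_mat)

lemma invertible_block_diag:
  assumes "invertible A" "invertible B"
  shows "invertible (block_diag A B)"
  unfolding invertible_right_inverse
  by (rule exI[of _ "block_diag (matrix_inv A) (matrix_inv B)"])
    (simp add: block_diag_mult matrix_inv_mult assms block_diag_mat)

lemma invertible_scaleR:
  fixes A :: "real^'n::finite^'n"
  assumes "invertible A" "c \<noteq> 0"
  shows "invertible (c *\<^sub>R A)" "matrix_inv (c *\<^sub>R A) = (1/c) *\<^sub>R matrix_inv A"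
proof -
  have *: "(c *\<^sub>R A) ** ((1/c) *\<^sub>R matrix_inv A) = mat 1"
  proof -
    have "(c *\<^sub>R A) ** ((1/c) *\<^sub>R matrix_inv A) = (c * (1/c)) *\<^sub>R (A ** matrix_inv A)"
      unfolding vec_eq_iff matrix_matrix_mult_def by (simp add: sum_distrib_left ac_simps)
    then show ?thesis using assms by (simp add: matrix_inv_mult)
  qed
  then show "invertible (c *\<^sub>R A)" unfolding invertible_right_inverse by blast
  show "matrix_inv (c *\<^sub>R A) = (1/c) *\<^sub>R matrix_inv A" by (rule matrix_inv_eqI[OF *])
qed

text \<open>Dividing an orthonormal basis for \<open>A\<close> by the square root of
  \<open>c\<close> makes it orthonormal for the scaled form, with the same signs.\<close>

lemma has_index_scaleR:
  fixes A :: "real^'n::finite^'n"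
  assumes "has_index A \<nu>" "c > 0"
  shows "has_index (c *\<^sub>R A) \<nu>"
proof -
  obtain P :: "real^'n^'n" and \<eta> where P: "invertible P" "\<forall>a. \<eta> a = 1 \<or> \<eta> a = -1"
    "transpose P ** A ** P = diag_matrix \<eta>" "card {a. \<eta> a = -1} = \<nu>"
    using assms(1) unfolding has_index_def by blast
  have "transpose ((1 / sqrt c) *\<^sub>R P) ** (c *\<^sub>R A) ** ((1 / sqrt c) *\<^sub>R P)
      = ((1 / sqrt c) * c * (1 / sqrt c)) *\<^sub>R (transpose P ** A ** P)"
    by (simp add: vec_eq_iff transpose_def matrix_matrix_mult_def sum_distrib_left sum_distrib_right
        ac_simps)
  also have "(1 / sqrt c) * c * (1 / sqrt c) = 1"
    using assms(2) by (simp add: field_simps flip: power2_eq_square)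
  finally show ?thesis
    unfolding has_index_def using P assms(2)
    by (intro exI[of _ "(1 / sqrt c) *\<^sub>R P"] exI[of _ \<eta>]) (simp add: invertible_scaleR)
qed

text \<open>Orthonormal bases of the two blocks combine to one of the orthogonal sum, and the
  numbers of timelike vectors add.\<close>

lemma has_index_block_diag:
  fixes A :: "real^'n::finite^'n" and B :: "real^'m::finite^'m"
  assumes "has_index A \<nu>" "has_index B \<mu>"
  shows "has_index (block_diag A B) (\<nu> + \<mu>)"
proof -
  obtain P :: "real^'n^'n" and \<eta> where P: "invertible P" "\<forall>a. \<eta> a = 1 \<or> \<eta> a = -1"
    "transpose P ** A ** P = diag_matrix \<eta>" "card {a. \<eta> a = -1} = \<nu>"
    using assms(1) unfolding has_index_def by blast
  obtain Q :: "real^'m^'m" and \<theta> where Q: "invertible Q" "\<forall>a. \<theta> a = 1 \<or> \<theta> a = -1"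
    "transpose Q ** B ** Q = diag_matrix \<theta>" "card {a. \<theta> a = -1} = \<mu>"
    using assms(2) unfolding has_index_def by blast
  have "{s. case_sum \<eta> \<theta> s = -1} = {a. \<eta> a = -1} <+> {b. \<theta> b = -1}"
    by (simp add: set_eq_iff split_sum_all Plus_def image_iff)
  then have "card {s. case_sum \<eta> \<theta> s = -1} = \<nu> + \<mu>"
    using P Q by (simp add: card_Plus)
  moreover have "block_diag (diag_matrix \<eta>) (diag_matrix \<theta>) = diag_matrix (case_sum \<eta> \<theta>)"
    by (simp add: vec_eq_iff split_sum_all diag_matrix_def)
  ultimately show ?thesis
    unfolding has_index_def using P Q
    by (intro exI[of _ "block_diag P Q"] exI[of _ "case_sum \<eta> \<theta>"])
      (simp add: invertible_block_diag transpose_block_diag block_diag_mult split_sum_all)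
qed

section \<open>Warped products\<close>

definition join_set :: "(real^'n::finite) set \<Rightarrow> (real^'m::finite) set \<Rightarrow> (real^('n + 'm)) set" where
  "join_set A B = {y. proj_left y \<in> A \<and> proj_right y \<in> B}"

lemma join_set_iff [simp]: "y \<in> join_set A B \<longleftrightarrow> proj_left y \<in> A \<and> proj_right y \<in> B"
  by (simp add: join_set_def)

lemma open_join_set:
  assumes "open A" "open B"
  shows "open (join_set A B)"
proof -
  have "join_set A B = proj_left -` A \<inter> proj_right -` B" by auto
  then show ?thesis
    using assms by (auto intro!: open_Int continuous_open_vimage linear_continuous_at bounded_linear_proj)
qed

lemma smooth_on_proj:
  assumes "open A" "open B"
  shows "smooth_on A f \<Longrightarrow> smooth_on (join_set A B) (\<lambda>y. f (proj_left y))"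
    and "smooth_on B g \<Longrightarrow> smooth_on (join_set A B) (\<lambda>y. g (proj_right y))"
proof -
  show "smooth_on (join_set A B) (\<lambda>y. f (proj_left y))" if "smooth_on A f"
    by (rule smooth_on_compose_linear[OF open_join_set[OF assms] bounded_linear_proj(1) _ that]) auto
  show "smooth_on (join_set A B) (\<lambda>y. g (proj_right y))" if "smooth_on B g"
    by (rule smooth_on_compose_linear[OF open_join_set[OF assms] bounded_linear_proj(2) _ that]) auto
qed

lemma smooth_on_join_vec:
  assumes "open A" "open B" "smooth_on A f" "smooth_on B g"
  shows "smooth_on (join_set A B) (\<lambda>y. join_vec (f (proj_left y)) (g (proj_right y)))"
  by (subst join_vec_split)
    (intro smooth_on_add open_join_set smooth_on_linear_compose[OF _ bounded_linear_join_vec(1)]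
      smooth_on_linear_compose[OF _ bounded_linear_join_vec(2)] smooth_on_proj assms)

lemma has_derivative_join_vec:
  assumes "(f has_derivative f') (at (proj_left y))" "(g has_derivative g') (at (proj_right y))"
  shows "((\<lambda>y. join_vec (f (proj_left y)) (g (proj_right y))) has_derivative
      (\<lambda>v. join_vec (f' (proj_left v)) (g' (proj_right v)))) (at y)"
proof -
  have "((\<lambda>y. join_vec (f (proj_left y)) 0 + join_vec 0 (g (proj_right y))) has_derivative
      (\<lambda>v. join_vec (f' (proj_left v)) 0 + join_vec 0 (g' (proj_right v)))) (at y)"
    by (intro has_derivative_add bounded_linear.has_derivative[OF bounded_linear_join_vec(1)]
        bounded_linear.has_derivative[OF bounded_linear_join_vec(2)]
        has_derivative_compose[OF bounded_linear_imp_has_derivative[OF bounded_linear_proj(1)] assms(1)]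
        has_derivative_compose[OF bounded_linear_imp_has_derivative[OF bounded_linear_proj(2)] assms(2)])
  then show ?thesis by (simp flip: join_vec_split)
qed

lemma jacobian_join_vec:
  assumes "f differentiable at (proj_left y)" "g differentiable at (proj_right y)"
  shows "jacobian (\<lambda>y. join_vec (f (proj_left y)) (g (proj_right y))) (at y)
     = block_diag (jacobian f (at (proj_left y))) (jacobian g (at (proj_right y)))"
proof -
  have "((\<lambda>y. join_vec (f (proj_left y)) (g (proj_right y))) has_derivative
      (\<lambda>v. join_vec (frechet_derivative f (at (proj_left y)) (proj_left v))
         (frechet_derivative g (at (proj_right y)) (proj_right v)))) (at y)"
    using assms by (intro has_derivative_join_vec) (simp_all flip: frechet_derivative_works)
  \<comment> \<open>A basis vector of one factor projects to zero in the other, where the derivative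
    vanishes by linearity; this yields the zero blocks.\<close>
  from frechet_derivative_at[OF this, symmetric] show ?thesis
    using linear_0[OF linear_frechet_derivative[OF assms(1)]]
      linear_0[OF linear_frechet_derivative[OF assms(2)]]
    by (simp add: jacobian_def matrix_def vec_eq_iff split_sum_all)
qed

section \<open>Charts, transition maps and the product atlas\<close>

lemma smooth_manifold_chart:
  assumes "smooth_manifold M" "i \<in> atlas M"
  shows "openin (mtop M) (chart_dom M i)" "open (chart_img M i)"
    and "homeomorphic_map (subtopology (mtop M) (chart_dom M i)) (top_of_set (chart_img M i)) (chart M i)"
    and "inj_on (chart M i) (chart_dom M i)"
    and "p \<in> chart_dom M i \<Longrightarrow> chart_inv M i (chart M i p) = p"
    and "y \<in> chart_img M i \<Longrightarrow> chart_inv M i y \<in> chart_dom M i"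
    and "y \<in> chart_img M i \<Longrightarrow> chart M i (chart_inv M i y) = y"
proof -
  show o: "openin (mtop M) (chart_dom M i)" "open (chart_img M i)"
    and h: "homeomorphic_map (subtopology (mtop M) (chart_dom M i)) (top_of_set (chart_img M i)) (chart M i)"
    using assms by (auto simp: smooth_manifold_def)
  have "topspace (subtopology (mtop M) (chart_dom M i)) = chart_dom M i"
    using openin_subset[OF o(1)] by (simp add: Int_absorb1)
  then show i: "inj_on (chart M i) (chart_dom M i)"
    using h by (simp add: homeomorphic_map_def)
  show "p \<in> chart_dom M i \<Longrightarrow> chart_inv M i (chart M i p) = p"
    using i by (simp add: chart_inv_def inv_into_f_f)
  show "y \<in> chart_img M i \<Longrightarrow> chart_inv M i y \<in> chart_dom M i"
    "y \<in> chart_img M i \<Longrightarrow> chart M i (chart_inv M i y) = y"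
    by (simp_all add: chart_inv_def chart_img_def inv_into_into f_inv_into_f)
qed

text \<open>A chart is a homeomorphism onto an open set, so images of relatively open sets are open
  in the model space. This makes \<open>smooth_on\<close> meaningful for transition maps.\<close>

lemma open_chart_overlap:
  assumes "smooth_manifold M" "i \<in> atlas M" "j \<in> atlas M"
  shows "open (chart M i ` (chart_dom M i \<inter> chart_dom M j))"
proof -
  note c = smooth_manifold_chart[OF assms(1,2)]
  have "openin (subtopology (mtop M) (chart_dom M i)) (chart_dom M i \<inter> chart_dom M j)"
    using smooth_manifold_chart(1)[OF assms(1,3)] c(1)
    by (metis inf_commute openin_subtopology_Int)
  then have "openin (top_of_set (chart_img M i)) (chart M i ` (chart_dom M i \<inter> chart_dom M j))"
    using homeomorphic_map_openness_eq[OF c(3)] by blast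
  then show ?thesis using c(2) openin_open_trans by blast
qed

lemma smooth_manifold_transition:
  assumes "smooth_manifold M" "i \<in> atlas M" "j \<in> atlas M"
  shows "smooth_on (chart M i ` (chart_dom M i \<inter> chart_dom M j)) (chart M j \<circ> chart_inv M i)"
  using assms by (simp add: smooth_manifold_def)

lemma second_countable_prod_topology:
  assumes "second_countable X" "second_countable Y"
  shows "second_countable (prod_topology X Y)"
proof -
  obtain A where A: "countable A" "\<forall>V\<in>A. openin X V"
      "\<forall>U x. openin X U \<and> x \<in> U \<longrightarrow> (\<exists>V\<in>A. x \<in> V \<and> V \<subseteq> U)"
    using assms(1) by (auto simp: second_countable_def)
  obtain B where B: "countable B" "\<forall>V\<in>B. openin Y V"
      "\<forall>U x. openin Y U \<and> x \<in> U \<longrightarrow> (\<exists>V\<in>B. x \<in> V \<and> V \<subseteq> U)"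
    using assms(2) by (auto simp: second_countable_def)
  show ?thesis
    unfolding second_countable_def
  proof (intro exI[of _ "(\<lambda>(V, W). V \<times> W) ` (A \<times> B)"] conjI allI impI ballI)
    show "countable ((\<lambda>(V, W). V \<times> W) ` (A \<times> B))" using A B by auto
    show "openin (prod_topology X Y) V" if "V \<in> (\<lambda>(V, W). V \<times> W) ` (A \<times> B)" for V
      using that A B by (auto simp: openin_prod_Times_iff)
    fix U x assume U: "openin (prod_topology X Y) U \<and> x \<in> U"
    obtain p q where x: "x = (p, q)" by fastforce
    obtain V W where "openin X V" "openin Y W" "p \<in> V" "q \<in> W" "V \<times> W \<subseteq> U"
      using U unfolding openin_prod_topology_alt x by meson
    moreover then obtain V' W' where "V' \<in> A" "p \<in> V'" "V' \<subseteq> V" "W' \<in> B" "q \<in> W'" "W' \<subseteq> W"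
      using A B by meson
    ultimately show "\<exists>V\<in>(\<lambda>(V, W). V \<times> W) ` (A \<times> B). x \<in> V \<and> V \<subseteq> U"
      unfolding x by (intro bexI[of _ "V' \<times> W'"]) auto
  qed
qed

lemma warped_product_simps [simp]:
  "mtop (warped_product B f F) = prod_topology (mtop B) (mtop F)"
  "atlas (warped_product B f F) = atlas B \<times> atlas F"
  "chart_dom (warped_product B f F) (i, j) = chart_dom B i \<times> chart_dom F j"
  "chart (warped_product B f F) (i, j) (p, q) = join_vec (chart B i p) (chart F j q)"
  "metric (warped_product B f F) (i, j) (p, q) = block_diag (metric B i p) ((f p)\<^sup>2 *\<^sub>R metric F j q)"
  by (simp_all add: warped_product_def)

text \<open>Arbitrary \<open>S\<close> and \<open>T\<close> cover both whole chart domains and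
  overlaps of two charts.\<close>

lemma warped_product_chart_image:
  "chart (warped_product B f F) (i, j) ` (S \<times> T) = join_set (chart B i ` S) (chart F j ` T)"
proof -
  have "y \<in> chart (warped_product B f F) (i, j) ` (S \<times> T)"
    if y: "proj_left y \<in> chart B i ` S" "proj_right y \<in> chart F j ` T" for y
  proof -
    obtain p q where "p \<in> S" "q \<in> T" "proj_left y = chart B i p" "proj_right y = chart F j q"
      using y by blast
    then have "y = chart (warped_product B f F) (i, j) (p, q)" by (metis join_vec_proj warped_product_simps(4))
    then show ?thesis using \<open>p \<in> S\<close> \<open>q \<in> T\<close> by blast
  qed
  then show ?thesis by auto
qed

lemma warped_product_chart_img:
  "chart_img (warped_product B f F) (i, j) = join_set (chart_img B i) (chart_img F j)"
  by (simp add: chart_img_def warped_product_chart_image)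

context
  fixes B :: "('p, 'i, 'n::finite) charted_metric_space" and F :: "('q, 'j, 'm::finite) charted_metric_space"
  assumes B: "smooth_manifold B" and F: "smooth_manifold F"
begin

lemma warped_product_chart_inv:
  assumes "i \<in> atlas B" "j \<in> atlas F" "proj_left y \<in> chart_img B i" "proj_right y \<in> chart_img F j"
  shows "chart_inv (warped_product B f F) (i, j) y = (chart_inv B i (proj_left y), chart_inv F j (proj_right y))"
proof -
  let ?W = "warped_product B f F"
  note b = smooth_manifold_chart[OF B assms(1)] and c = smooth_manifold_chart[OF F assms(2)]
  let ?r = "(chart_inv B i (proj_left y), chart_inv F j (proj_right y))"
  have "inj_on (chart ?W (i, j)) (chart_dom ?W (i, j))"
    using b(4) c(4) by (auto simp: inj_on_def)
  moreover have "chart ?W (i, j) ?r = y"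
    using b(7) c(7) assms by simp
  moreover have "?r \<in> chart_dom ?W (i, j)" using b(6) c(6) assms by simp
  ultimately show ?thesis unfolding chart_inv_def by (metis inv_into_f_f)
qed

lemma warped_product_smooth_function:
  assumes "smooth_function B u"
  shows "smooth_function (warped_product B f F) (\<lambda>(p, q). u p)"
  unfolding smooth_function_def
proof
  fix ij assume "ij \<in> atlas (warped_product B f F)"
  then obtain i j where ij: "ij = (i, j)" "i \<in> atlas B" "j \<in> atlas F" by auto
  note b = smooth_manifold_chart[OF B ij(2)] and c = smooth_manifold_chart[OF F ij(3)]
  have "smooth_on (join_set (chart_img B i) (chart_img F j)) (\<lambda>y. (u \<circ> chart_inv B i) (proj_left y))"
    using assms ij b c by (intro smooth_on_proj(1)) (auto simp: smooth_function_def o_def)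
  then show "smooth_on (chart_img (warped_product B f F) ij)
      ((\<lambda>(p, q). u p) \<circ> chart_inv (warped_product B f F) ij)"
    unfolding ij warped_product_chart_img
    by (rule smooth_on_cong_imp[OF open_join_set, rotated 3])
      (use ij b c in \<open>auto simp: warped_product_chart_inv\<close>)
qed

lemma warped_product_smooth_manifold: "smooth_manifold (warped_product B f F)"
proof -
  let ?W = "warped_product B f F"
  have "openin (mtop ?W) (chart_dom ?W ij) \<and> open (chart_img ?W ij) \<and>
      homeomorphic_map (subtopology (mtop ?W) (chart_dom ?W ij)) (top_of_set (chart_img ?W ij)) (chart ?W ij)"
    if ij': "ij \<in> atlas ?W" for ij
  proof -
    obtain i j where ij: "ij = (i, j)" "i \<in> atlas B" "j \<in> atlas F" using ij' by auto
    note b = smooth_manifold_chart[OF B ij(2)] and c = smooth_manifold_chart[OF F ij(3)]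
    obtain g h where "homeomorphic_maps (subtopology (mtop B) (chart_dom B i)) (top_of_set (chart_img B i)) (chart B i) g"
        "homeomorphic_maps (subtopology (mtop F) (chart_dom F j)) (top_of_set (chart_img F j)) (chart F j) h"
      using b(3) c(3) by (auto simp: homeomorphic_map_maps)
    then have m1: "homeomorphic_maps (subtopology (mtop ?W) (chart_dom ?W ij))
        (top_of_set (chart_img B i \<times> chart_img F j)) (\<lambda>(p, q). (chart B i p, chart F j q)) (\<lambda>(p, q). (g p, h q))"
      by (simp add: ij subtopology_Times homeomorphic_maps_prod flip: prod_topology_subtopology_eu)
    \<comment> \<open>Regrouping a pair of vectors into one vector over the sum of the index types
      is a linear homeomorphism; it turns the product of two charts into a chart with values in the
      model space of the product.\<close>
    have m2: "homeomorphic_maps (top_of_set (chart_img B i \<times> chart_img F j)) (top_of_set (chart_img ?W ij))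
        (\<lambda>(x, z). join_vec x z) (\<lambda>y. (proj_left y, proj_right y))"
    proof -
      have "continuous_on S (\<lambda>(x, z). join_vec x z)" for S :: "((real^'n) \<times> (real^'m)) set"
        unfolding case_prod_unfold
        by (subst join_vec_split) (intro continuous_intros
            bounded_linear.continuous_on[OF bounded_linear_join_vec(1)]
            bounded_linear.continuous_on[OF bounded_linear_join_vec(2)])
      moreover have "continuous_on S (\<lambda>y. (proj_left y, proj_right y))" for S :: "(real^('n + 'm)) set"
        by (intro continuous_on_Pair linear_continuous_on bounded_linear_proj)
      ultimately show ?thesis
        unfolding ij warped_product_chart_img by (auto simp: homeomorphic_maps_def)
    qed
    have "homeomorphic_map (subtopology (mtop ?W) (chart_dom ?W ij)) (top_of_set (chart_img ?W ij))
        ((\<lambda>(x, z). join_vec x z) \<circ> (\<lambda>(p, q). (chart B i p, chart F j q)))"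
      unfolding homeomorphic_map_maps by (rule exI) (rule homeomorphic_maps_compose[OF conjI[OF m1 m2]])
    moreover have "(\<lambda>(x, z). join_vec x z) \<circ> (\<lambda>(p, q). (chart B i p, chart F j q)) = chart ?W ij"
      by (auto simp: ij fun_eq_iff)
    ultimately show ?thesis
      using b c by (auto simp: ij openin_prod_Times_iff warped_product_chart_img open_join_set)
  qed
  moreover have "smooth_on (chart ?W ij ` (chart_dom ?W ij \<inter> chart_dom ?W kl)) (chart ?W kl \<circ> chart_inv ?W ij)"
    if ijkl: "ij \<in> atlas ?W" "kl \<in> atlas ?W" for ij kl
  proof -
    obtain i j k l where ij: "ij = (i, j)" "i \<in> atlas B" "j \<in> atlas F"
      and kl: "kl = (k, l)" "k \<in> atlas B" "l \<in> atlas F" using ijkl by auto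
    let ?S = "chart B i ` (chart_dom B i \<inter> chart_dom B k)" and ?T = "chart F j ` (chart_dom F j \<inter> chart_dom F l)"
    have ST: "open ?S" "open ?T"
      using ij kl by (simp_all add: open_chart_overlap B F)
    have "smooth_on (join_set ?S ?T)
        (\<lambda>y. join_vec ((chart B k \<circ> chart_inv B i) (proj_left y)) ((chart F l \<circ> chart_inv F j) (proj_right y)))"
      by (intro smooth_on_join_vec ST smooth_manifold_transition B F ij kl)
    then have "smooth_on (join_set ?S ?T) (chart ?W kl \<circ> chart_inv ?W ij)"
      by (rule smooth_on_cong_imp[OF open_join_set[OF ST], rotated])
        (use ij kl in \<open>auto simp: warped_product_chart_inv chart_img_def\<close>)
    then show ?thesis
      by (simp add: ij kl Times_Int_Times warped_product_chart_image)
  qed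
  moreover have "(\<Union>ij\<in>atlas ?W. chart_dom ?W ij) = topspace (mtop ?W)"
  proof -
    have *: "(\<Union>i\<in>atlas B. chart_dom B i) = topspace (mtop B)" "(\<Union>j\<in>atlas F. chart_dom F j) = topspace (mtop F)"
      using B F unfolding smooth_manifold_def by blast+
    have "(\<Union>ij\<in>atlas ?W. chart_dom ?W ij) = (\<Union>i\<in>atlas B. chart_dom B i) \<times> (\<Union>j\<in>atlas F. chart_dom F j)"
      by auto
    then show ?thesis by (simp add: *)
  qed
  moreover have "Hausdorff_space (mtop ?W)" "second_countable (mtop ?W)"
    using B F by (auto simp: smooth_manifold_def Hausdorff_space_prod_topology second_countable_prod_topology)
  ultimately show ?thesis unfolding smooth_manifold_def by (intro conjI ballI) simp_all
qed

end

section \<open>The warped product metric\<close>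

lemma smooth_chart_transition_differentiable:
  assumes "smooth_manifold M" "i \<in> atlas M" "j \<in> atlas M" "p \<in> chart_dom M i \<inter> chart_dom M j"
  shows "(chart M j \<circ> chart_inv M i) differentiable at (chart M i p)"
  using smooth_on_has_derivative[OF smooth_manifold_transition[OF assms(1-3)] imageI[OF assms(4)]]
  by (rule differentiableI)

lemma semi_riemannian_manifoldD:
  assumes "semi_riemannian_manifold M"
  shows "smooth_manifold M"
    and "i \<in> atlas M \<Longrightarrow> smooth_on (chart_img M i) (metric M i \<circ> chart_inv M i)"
    and "i \<in> atlas M \<Longrightarrow> j \<in> atlas M \<Longrightarrow> p \<in> chart_dom M i \<inter> chart_dom M j \<Longrightarrow>
      metric M i p = transpose (jacobian (chart M j \<circ> chart_inv M i) (at (chart M i p))) ** metric M j p **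
        jacobian (chart M j \<circ> chart_inv M i) (at (chart M i p))"
    and "i \<in> atlas M \<Longrightarrow> p \<in> chart_dom M i \<Longrightarrow> transpose (metric M i p) = metric M i p"
    and "i \<in> atlas M \<Longrightarrow> p \<in> chart_dom M i \<Longrightarrow> invertible (metric M i p)"
    and "\<exists>\<nu>. \<forall>i\<in>atlas M. \<forall>p\<in>chart_dom M i. has_index (metric M i p) \<nu>"
proof -
  note a = assms[unfolded semi_riemannian_manifold_def Let_def]
  note b = conjunct2[OF a] note c = conjunct2[OF b] note d = conjunct2[OF c]
  show "smooth_manifold M" using a by (rule conjunct1)
  show "i \<in> atlas M \<Longrightarrow> smooth_on (chart_img M i) (metric M i \<circ> chart_inv M i)"
    using conjunct1[OF b] by (rule bspec)
  show "metric M i p = transpose (jacobian (chart M j \<circ> chart_inv M i) (at (chart M i p))) ** metric M j p **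
        jacobian (chart M j \<circ> chart_inv M i) (at (chart M i p))"
    if "i \<in> atlas M" "j \<in> atlas M" "p \<in> chart_dom M i \<inter> chart_dom M j"
    using bspec[OF bspec[OF bspec[OF conjunct1[OF c] that(1)] that(2)] that(3)] .
  show "i \<in> atlas M \<Longrightarrow> p \<in> chart_dom M i \<Longrightarrow> transpose (metric M i p) = metric M i p"
    "i \<in> atlas M \<Longrightarrow> p \<in> chart_dom M i \<Longrightarrow> invertible (metric M i p)"
    using conjunct1[OF d] by simp_all
  show "\<exists>\<nu>. \<forall>i\<in>atlas M. \<forall>p\<in>chart_dom M i. has_index (metric M i p) \<nu>"
    using d by (rule conjunct2)
qed

text \<open>Gram matrices and transition Jacobians are block diagonal, so each condition splits into
  one on the base and one on the fiber. The factor f^2 depends on the base point and not on the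
  chart, hence respects changes of charts; being positive, it preserves nondegeneracy and
  index.\<close>

proposition warped_product_semi_riemannian:
  fixes B :: "('p, 'i, 'n::finite) charted_metric_space" and F :: "('q, 'j, 'm::finite) charted_metric_space"
  assumes B: "semi_riemannian_manifold B" and F: "semi_riemannian_manifold F" and f: "warping_function B f"
  shows "semi_riemannian_manifold (warped_product B f F)"
proof -
  let ?W = "warped_product B f F"
  have sB: "smooth_manifold B" and sF: "smooth_manifold F"
    by (simp_all add: semi_riemannian_manifoldD(1) B F)
  have pos: "f p > 0" if "i \<in> atlas B" "p \<in> chart_dom B i" for i p
    using f openin_subset[OF smooth_manifold_chart(1)[OF sB that(1)]] that(2)
    by (auto simp: warping_function_def)
  have m1: "smooth_on (chart_img ?W ij) (metric ?W ij \<circ> chart_inv ?W ij)" if ij': "ij \<in> atlas ?W" for ij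
  proof -
    obtain i j where ij: "ij = (i, j)" "i \<in> atlas B" "j \<in> atlas F" using ij' by auto
    note b = smooth_manifold_chart[OF sB ij(2)] and c = smooth_manifold_chart[OF sF ij(3)]
    have sm: "smooth_on (chart_img B i) (f \<circ> chart_inv B i)"
        "smooth_on (chart_img B i) (metric B i \<circ> chart_inv B i)"
        "smooth_on (chart_img F j) (metric F j \<circ> chart_inv F j)"
      using f ij semi_riemannian_manifoldD(2)[OF B] semi_riemannian_manifoldD(2)[OF F]
      by (simp_all add: warping_function_def smooth_function_def)
    note S = open_join_set[OF b(2) c(2)]
    \<comment> \<open>The square is written as a product, and the blocks are separated, so that the
      rules for bilinear and linear maps apply.\<close>
    have "smooth_on (join_set (chart_img B i) (chart_img F j))
      (\<lambda>y. block_diag ((metric B i \<circ> chart_inv B i) (proj_left y)) 0 +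
         block_diag 0 (((f \<circ> chart_inv B i) (proj_left y) * (f \<circ> chart_inv B i) (proj_left y)) *\<^sub>R
           (metric F j \<circ> chart_inv F j) (proj_right y)))"
      by (intro smooth_on_add S smooth_on_linear_compose[OF S bounded_linear_block_diag(1)]
          smooth_on_linear_compose[OF S bounded_linear_block_diag(2)]
          smooth_on_bilinear[OF S bounded_bilinear_scaleR] smooth_on_bilinear[OF S bounded_bilinear_mult]
          smooth_on_proj(1)[OF b(2) c(2) sm(1)] smooth_on_proj(1)[OF b(2) c(2) sm(2)]
          smooth_on_proj(2)[OF b(2) c(2) sm(3)])
    then show ?thesis unfolding ij warped_product_chart_img
      by (rule smooth_on_cong_imp[OF S, rotated])
        (use ij in \<open>auto simp: warped_product_chart_inv[OF sB sF] power2_eq_square simp flip: block_diag_split\<close>)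
  qed
  have m2: "metric ?W ij p = transpose J ** metric ?W kl p ** J"
    if ijkl: "ij \<in> atlas ?W" "kl \<in> atlas ?W" "p \<in> chart_dom ?W ij \<inter> chart_dom ?W kl"
      and J: "J = jacobian (chart ?W kl \<circ> chart_inv ?W ij) (at (chart ?W ij p))" for ij kl p J
  proof -
    obtain i j k l x z where ij: "ij = (i, j)" "i \<in> atlas B" "j \<in> atlas F"
      and kl: "kl = (k, l)" "k \<in> atlas B" "l \<in> atlas F" and p: "p = (x, z)"
      using ijkl by (cases p) auto
    have x: "x \<in> chart_dom B i \<inter> chart_dom B k" and z: "z \<in> chart_dom F j \<inter> chart_dom F l"
      using ijkl ij kl p by auto
    let ?S = "chart B i ` (chart_dom B i \<inter> chart_dom B k)" and ?T = "chart F j ` (chart_dom F j \<inter> chart_dom F l)"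
    let ?JB = "jacobian (chart B k \<circ> chart_inv B i) (at (chart B i x))"
    let ?JF = "jacobian (chart F l \<circ> chart_inv F j) (at (chart F j z))"
    have ST: "open (join_set ?S ?T)"
      using ij kl by (intro open_join_set open_chart_overlap sB sF)
    let ?g = "\<lambda>y. join_vec ((chart B k \<circ> chart_inv B i) (proj_left y)) ((chart F l \<circ> chart_inv F j) (proj_right y))"
    let ?y = "chart ?W ij p"
    have d: "(chart B k \<circ> chart_inv B i) differentiable at (proj_left ?y)"
        "(chart F l \<circ> chart_inv F j) differentiable at (proj_right ?y)"
      using smooth_chart_transition_differentiable[OF sB ij(2) kl(2) x]
        smooth_chart_transition_differentiable[OF sF ij(3) kl(3) z] by (simp_all add: ij p)
    have "?g differentiable at ?y"
      using has_derivative_join_vec[OF d[unfolded frechet_derivative_works]] differentiableI by blast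
    \<comment> \<open>The transition map of the product is known to be \<open>?g\<close> on the
      image of the overlap, an open set around \<open>?y\<close>, which determines the derivative
      there.\<close>
    then have "frechet_derivative ?g (at ?y) = frechet_derivative (chart ?W kl \<circ> chart_inv ?W ij) (at ?y)"
      by (rule frechet_derivative_transform_within_open[OF _ ST])
        (use ij kl p x z in \<open>auto simp: warped_product_chart_inv[OF sB sF] chart_img_def\<close>)
    then have "J = block_diag ?JB ?JF"
      using jacobian_join_vec[OF d] unfolding J jacobian_def by (simp add: ij p)
    moreover have "metric B i x = transpose ?JB ** metric B k x ** ?JB"
      by (rule semi_riemannian_manifoldD(3)[OF B ij(2) kl(2) x])
    moreover have "metric F j z = transpose ?JF ** metric F l z ** ?JF"
      by (rule semi_riemannian_manifoldD(3)[OF F ij(3) kl(3) z])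
    then have "c *\<^sub>R metric F j z = transpose ?JF ** (c *\<^sub>R metric F l z) ** ?JF" for c
      by (simp add: vec_eq_iff matrix_matrix_mult_def sum_distrib_left sum_distrib_right ac_simps)
    ultimately show ?thesis
      by (simp add: ij kl p transpose_block_diag block_diag_mult)
  qed
  have m3: "transpose (metric ?W ij p) = metric ?W ij p \<and> invertible (metric ?W ij p)"
    if ijp: "ij \<in> atlas ?W" "p \<in> chart_dom ?W ij" for ij p
  proof -
    obtain i j x z where ij: "ij = (i, j)" "i \<in> atlas B" "j \<in> atlas F" "p = (x, z)"
      "x \<in> chart_dom B i" "z \<in> chart_dom F j"
      using ijp by (cases p) auto
    have "transpose (c *\<^sub>R metric F j z) = c *\<^sub>R transpose (metric F j z)" for c
      by (simp add: vec_eq_iff transpose_def)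
    then show ?thesis
      using ij pos[OF ij(2,5)] semi_riemannian_manifoldD(4,5)[OF B ij(2,5)] semi_riemannian_manifoldD(4,5)[OF F ij(3,6)]
      by (auto simp: transpose_block_diag intro!: invertible_block_diag invertible_scaleR)
  qed
  have m4: "\<exists>\<nu>. \<forall>ij\<in>atlas ?W. \<forall>p\<in>chart_dom ?W ij. has_index (metric ?W ij p) \<nu>"
  proof -
    obtain \<nu> where "\<forall>i\<in>atlas B. \<forall>p\<in>chart_dom B i. has_index (metric B i p) \<nu>"
      using semi_riemannian_manifoldD(6)[OF B] by blast
    moreover obtain \<mu> where "\<forall>j\<in>atlas F. \<forall>p\<in>chart_dom F j. has_index (metric F j p) \<mu>"
      using semi_riemannian_manifoldD(6)[OF F] by blast
    moreover have "(f p)\<^sup>2 > 0" if "i \<in> atlas B" "p \<in> chart_dom B i" for i p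
      using pos[OF that] by simp
    ultimately show ?thesis
      by (intro exI[of _ "\<nu> + \<mu>"]) (simp add: has_index_block_diag has_index_scaleR split_paired_all del: zero_less_power2)
  qed
  show ?thesis
    unfolding semi_riemannian_manifold_def Let_def
    by (rule conjI[OF warped_product_smooth_manifold[OF sB sF]], rule conjI[rotated], rule conjI[rotated],
        rule conjI[rotated], rule m4, (rule ballI)+, rule m3, assumption+, (rule ballI)+,
        rule m2[OF _ _ _ refl], assumption+, rule ballI, rule m1, assumption)
qed

section \<open>Partial derivatives and Christoffel symbols\<close>

text \<open>Both functions have the same candidates for a derivative at \<open>y\<close>, so the
  choice made by \<open>frechet_derivative\<close> is the same even at a point where neither is
  differentiable.\<close>

lemma partial_cong:
  assumes "open S" "y \<in> S" "\<And>x. x \<in> S \<Longrightarrow> f x = g x"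
  shows "partial s f y = partial s g y"
proof -
  have "(f has_derivative D) (at y) \<longleftrightarrow> (g has_derivative D) (at y)" for D
    using has_derivative_transform_within_open[OF _ assms(1,2)] assms(3) by metis
  then show ?thesis by (simp add: partial_def frechet_derivative_def)
qed

lemma partial_eqI:
  assumes "(f has_derivative D) (at y)"
  shows "partial s f y = D (axis s 1)"
  using frechet_derivative_at[OF assms] by (simp add: partial_def)

lemma partial_const [simp]: "partial s (\<lambda>_. c) y = 0"
  by (simp add: partial_def)

lemma differentiable_prod:
  fixes f :: "'i \<Rightarrow> 'a::real_normed_vector \<Rightarrow> real"
  assumes "\<And>i. i \<in> I \<Longrightarrow> f i differentiable at x"
  shows "(\<lambda>z. \<Prod>i\<in>I. f i z) differentiable at x"
  using assms by (induction I rule: infinite_finite_induct) (auto intro!: differentiable_mult)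

lemma differentiable_det:
  fixes M :: "'a::real_normed_vector \<Rightarrow> real^'m::finite^'m"
  assumes "\<And>i j. (\<lambda>z. M z $ i $ j) differentiable at x"
  shows "(\<lambda>z. det (M z)) differentiable at x"
  unfolding det_def
  by (intro differentiable_sum ballI differentiable_mult differentiable_prod assms) auto

text \<open>Column \<open>l\<close> of the inverse solves M x = e_l, to which Cramer's rule
  applies.\<close>

lemma matrix_inv_cramer:
  fixes M :: "real^'m::finite^'m"
  assumes "invertible M"
  shows "matrix_inv M $ c $ l = det (\<chi> i j. if j = c then axis l 1 $ i else M $ i $ j) / det M"
proof -
  have "M *v (matrix_inv M *v axis l 1) = axis l 1"
    using assms by (simp add: matrix_vector_mul_assoc matrix_inv_mult)
  then have "matrix_inv M *v axis l 1 = (\<chi> c. det (\<chi> i j. if j = c then axis l 1 $ i else M $ i $ j) / det M)"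
    using assms by (simp add: cramer invertible_det_nz)
  moreover have "(matrix_inv M *v axis l 1) $ c = matrix_inv M $ c $ l"
    by (simp add: matrix_vector_mult_basis column_def)
  ultimately show ?thesis by simp
qed

text \<open>Cramer's rule writes an entry of the inverse as a quotient of polynomials in the entries
  of \<open>M\<close>; the formula holds throughout the neighbourhood \<open>S\<close> of the
  point.\<close>

lemma matrix_inv_differentiable:
  fixes M :: "'a::real_normed_vector \<Rightarrow> real^'m::finite^'m"
  assumes M: "\<And>i j. (\<lambda>z. M z $ i $ j) differentiable at x"
    and S: "open S" "x \<in> S" "\<And>z. z \<in> S \<Longrightarrow> invertible (M z)"
  shows "(\<lambda>z. matrix_inv (M z) $ c $ l) differentiable at x"
proof -
  have "(\<lambda>z. (\<chi> i j. if j = c then axis l 1 $ i else M z $ i $ j) $ i $ j) differentiable at x" for i j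
    by (cases "j = c") (simp_all add: M)
  then have "(\<lambda>z. det (\<chi> i j. if j = c then axis l 1 $ i else M z $ i $ j) / det (M z)) differentiable at x"
    using S by (intro differentiable_divide differentiable_det) (auto simp: M invertible_det_nz)
  then show ?thesis
    using has_derivative_transform_within_open[OF _ S(1,2)] matrix_inv_cramer[OF S(3)]
    unfolding differentiable_def by (metis (no_types, lifting))
qed

text \<open>Taking an entry is linear, so the partial derivative of an entry of \<gamma> is an entry
  of a directional derivative of \<gamma>, which is smooth again.\<close>

lemma partial_differentiable:
  fixes \<gamma> :: "real^'m::finite \<Rightarrow> real^'m^'m"
  assumes V: "open V" "z \<in> V" and \<gamma>: "smooth_on V \<gamma>"
  shows "(\<lambda>z. \<gamma> z $ p $ q) differentiable at z"
    and "partial a (\<lambda>z. \<gamma> z $ p $ q) differentiable at z"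
proof -
  have d: "((\<lambda>z. \<gamma> z $ p $ q) has_derivative (\<lambda>v. frechet_derivative \<gamma> (at x) v $ p $ q)) (at x)"
    if "x \<in> V" for x
    by (rule bounded_linear.has_derivative[OF bounded_linear_matrix_component smooth_on_has_derivative[OF \<gamma> that]])
  then show "(\<lambda>z. \<gamma> z $ p $ q) differentiable at z" using V(2) differentiableI by blast
  have "((\<lambda>x. frechet_derivative \<gamma> (at x) (axis a 1) $ p $ q) has_derivative
      (\<lambda>v. frechet_derivative (\<lambda>x. frechet_derivative \<gamma> (at x) (axis a 1)) (at z) v $ p $ q)) (at z)"
    by (rule bounded_linear.has_derivative[OF bounded_linear_matrix_component
        smooth_on_has_derivative[OF smooth_on_frechet_derivative[OF \<gamma>] V(2)]])
  then have "(partial a (\<lambda>z. \<gamma> z $ p $ q) has_derivative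
      (\<lambda>v. frechet_derivative (\<lambda>x. frechet_derivative \<gamma> (at x) (axis a 1)) (at z) v $ p $ q)) (at z)"
    by (rule has_derivative_transform_within_open[OF _ V]) (simp add: partial_eqI[OF d])
  then show "partial a (\<lambda>z. \<gamma> z $ p $ q) differentiable at z" by (rule differentiableI)
qed

text \<open>Curvature differentiates the Christoffel symbols. Those of the fiber are not computed,
  and differentiability is what the product rule has to know about them.\<close>

lemma christoffel_differentiable:
  fixes \<gamma> :: "real^'m::finite \<Rightarrow> real^'m^'m"
  assumes V: "open V" "z \<in> V" and \<gamma>: "smooth_on V \<gamma>" "\<And>z. z \<in> V \<Longrightarrow> invertible (\<gamma> z)"
  shows "christoffel \<gamma> c a b differentiable at z"
  unfolding christoffel_def[abs_def]
  by (intro differentiable_mult differentiable_sum ballI differentiable_add differentiable_diff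
      partial_differentiable[OF V \<gamma>(1)] matrix_inv_differentiable[OF _ V \<gamma>(2)]) auto

text \<open>The symmetry of \<gamma> is known on \<open>V\<close>, so the partial derivatives are
  compared near \<open>z\<close>. The lemma serves the mixed Ricci components with the fiber index
  first.\<close>

lemma christoffel_commute:
  assumes "open V" "z \<in> V" "\<And>z. z \<in> V \<Longrightarrow> transpose (\<gamma> z) = \<gamma> z"
  shows "christoffel \<gamma> c a b z = christoffel \<gamma> c b a z"
proof -
  have "partial l (\<lambda>z. \<gamma> z $ a $ b) z = partial l (\<lambda>z. \<gamma> z $ b $ a) z" for l
  proof (rule partial_cong[OF assms(1,2)])
    show "\<gamma> x $ a $ b = \<gamma> x $ b $ a" if "x \<in> V" for x
      using assms(3)[OF that] by (simp add: vec_eq_iff transpose_def)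
  qed
  then show ?thesis by (simp add: christoffel_def add.commute)
qed

text \<open>Divergence, gradient of the trace, trace times symbol, and a quadratic term: the four
  sums are evaluated separately later. Exchanging the order of summation in the third isolates the
  trace, which has a simple closed form.\<close>

lemma ricci_coord_eq:
  "ricci_coord G y $ p $ q =
     (\<Sum>l\<in>UNIV. partial l (christoffel G l p q) y) - (\<Sum>l\<in>UNIV. partial p (christoffel G l l q) y)
     + (\<Sum>s\<in>UNIV. (\<Sum>l\<in>UNIV. christoffel G l l s y) * christoffel G s p q y)
     - (\<Sum>l\<in>UNIV. \<Sum>s\<in>UNIV. christoffel G l p s y * christoffel G s l q y)"
  unfolding ricci_coord_def riemann_def
  by (simp add: sum.distrib sum_subtractf sum_distrib_right)
    (subst sum.swap, simp)

section \<open>Curvature of a warped product over a half space\<close>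

text \<open>One product chart over the half space. \<open>A\<close> stands for \<phi>^-2 and
  \<open>B\<close> for f^2 as functions of u, given by positivity and logarithmic derivatives.
  \<open>E\<close> is the scalar square of the covector \<alpha>. \<open>G\<close> is prescribed on
  the chart image only, because the metric read through \<open>chart_inv\<close> is arbitrary
  elsewhere.\<close>

locale warped_chart =
  fixes \<epsilon> :: "'n::finite \<Rightarrow> real" and \<alpha> :: "real^'n" and k N b E :: real
    and A B :: "real \<Rightarrow> real"
    and \<gamma> :: "real^'m::finite \<Rightarrow> real^'m^'m" and V :: "(real^'m) set" and \<Omega> :: "(real^'n) set"
    and G :: "real^('n + 'm) \<Rightarrow> real^('n + 'm)^('n + 'm)"
  assumes \<epsilon>: "\<And>i. \<epsilon> i * \<epsilon> i = 1" and E: "(\<Sum>i\<in>UNIV. \<epsilon> i * (\<alpha> $ i)\<^sup>2) = E"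
    and N: "N \<noteq> 0"
    and A: "\<And>u. u > 0 \<Longrightarrow> A u > 0"
      "\<And>u. u > 0 \<Longrightarrow> (A has_real_derivative (2 * k / N) * A u / u) (at u)"
    and B: "\<And>u. u > 0 \<Longrightarrow> B u > 0"
      "\<And>u. u > 0 \<Longrightarrow> (B has_real_derivative (- 2 / N) * B u / u) (at u)"
    and V: "open V" and \<gamma>: "smooth_on V \<gamma>" "\<And>z. z \<in> V \<Longrightarrow> transpose (\<gamma> z) = \<gamma> z"
      "\<And>z. z \<in> V \<Longrightarrow> invertible (\<gamma> z)"
    and \<Omega>: "\<Omega> = {x. N * (\<Sum>i\<in>UNIV. \<alpha> $ i * x $ i) + b > 0}"
    and G: "\<And>y. proj_left y \<in> \<Omega> \<Longrightarrow> proj_right y \<in> V \<Longrightarrow>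
       G y = block_diag (A (N * (\<Sum>i\<in>UNIV. \<alpha> $ i * y $ Inl i) + b) *\<^sub>R diag_matrix \<epsilon>)
         (B (N * (\<Sum>i\<in>UNIV. \<alpha> $ i * y $ Inl i) + b) *\<^sub>R \<gamma> (proj_right y))"
begin

definition U :: "real^('n + 'm) \<Rightarrow> real" where
  "U y = N * (\<Sum>i\<in>UNIV. \<alpha> $ i * y $ Inl i) + b"

abbreviation D :: "(real^('n + 'm)) set" where "D \<equiv> join_set \<Omega> V"

lemma open_D: "open D"
proof -
  have "open \<Omega>" unfolding \<Omega> by (intro open_Collect_less continuous_intros)
  then show ?thesis by (intro open_join_set V)
qed

lemma U_pos: "y \<in> D \<Longrightarrow> U y > 0"
  by (simp add: \<Omega> U_def)

lemma G_eq:
  "y \<in> D \<Longrightarrow> G y = block_diag (A (U y) *\<^sub>R diag_matrix \<epsilon>) (B (U y) *\<^sub>R \<gamma> (proj_right y))"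
  using G by (simp add: U_def)

lemma has_derivative_U: "(U has_derivative (\<lambda>v. N * (\<Sum>i\<in>UNIV. \<alpha> $ i * v $ Inl i))) (at y)"
  unfolding U_def[abs_def]
  by (rule has_derivative_eq_rhs)
    (auto intro!: derivative_eq_intros bounded_linear_imp_has_derivative[OF bounded_linear_component])

text \<open>Base directions act on \<open>p\<close> alone and fiber directions on \<open>v\<close>
  alone. The nonzero metric entries, the nonzero Christoffel symbols and the potential all have this
  product form.\<close>

lemma partial_separable:
  assumes "(p has_real_derivative p') (at (U y))" "v differentiable at (proj_right y)"
  shows "partial (Inl i) (\<lambda>y. p (U y) * v (proj_right y)) y = N * \<alpha> $ i * p' * v (proj_right y)"
    and "partial (Inr a) (\<lambda>y. p (U y) * v (proj_right y)) y = p (U y) * partial a v (proj_right y)"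
proof -
  let ?v = "frechet_derivative v (at (proj_right y))"
  have v: "(v has_derivative ?v) (at (proj_right y))"
    using assms(2) by (simp flip: frechet_derivative_works)
  have d: "((\<lambda>y. p (U y) * v (proj_right y)) has_derivative
      (\<lambda>h. p (U y) * ?v (proj_right h) + p' * (N * (\<Sum>i\<in>UNIV. \<alpha> $ i * h $ Inl i)) * v (proj_right y))) (at y)"
    by (intro has_derivative_mult
        has_derivative_compose[OF has_derivative_U assms(1)[unfolded has_field_derivative_def]]
        has_derivative_compose[OF bounded_linear_imp_has_derivative[OF bounded_linear_proj(2)] v])
  have "(\<Sum>j\<in>UNIV. \<alpha> $ j * axis (Inl i) 1 $ (Inl j :: 'n + 'm)) = \<alpha> $ i" for i
    by (simp add: axis_def if_distrib[of "\<lambda>x. _ * x"] cong: if_cong)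
  moreover have "(\<Sum>j\<in>UNIV. \<alpha> $ j * axis (Inr a) 1 $ (Inl j :: 'n + 'm)) = 0" for a
    by (simp add: axis_def)
  ultimately show "partial (Inl i) (\<lambda>y. p (U y) * v (proj_right y)) y = N * \<alpha> $ i * p' * v (proj_right y)"
    "partial (Inr a) (\<lambda>y. p (U y) * v (proj_right y)) y = p (U y) * partial a v (proj_right y)"
    unfolding partial_eqI[OF d] using linear_0[OF has_derivative_linear[OF v]]
    by (simp_all add: partial_def)
qed

lemma partial_base:
  assumes "(p has_real_derivative p') (at (U y))"
  shows "partial (Inl i) (\<lambda>y. p (U y) * c) y = N * \<alpha> $ i * p' * c"
    and "partial (Inr a) (\<lambda>y. p (U y) * c) y = 0"
  by (simp_all add: partial_separable[OF assms differentiable_const])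

lemma partial_fiber:
  fixes y :: "real^('n + 'm)"
  assumes "v differentiable at (proj_right y)"
  shows "partial (Inl i) (\<lambda>y. v (proj_right y)) y = 0"
    and "partial (Inr a) (\<lambda>y. v (proj_right y)) y = partial a v (proj_right y)"
  using partial_separable[OF DERIV_const[of "1::real"] assms] by simp_all

lemma matrix_inv_G:
  assumes "y \<in> D"
  shows "matrix_inv (G y) = block_diag ((1 / A (U y)) *\<^sub>R diag_matrix \<epsilon>) ((1 / B (U y)) *\<^sub>R matrix_inv (\<gamma> (proj_right y)))"
proof -
  have "diag_matrix \<epsilon> ** diag_matrix \<epsilon> = mat 1"
    by (simp add: vec_eq_iff matrix_matrix_mult_def diag_matrix_def mat_def \<epsilon>
        if_distrib[of "\<lambda>x. _ * x"] if_distrib[of "\<lambda>x. x * _"] cong: if_cong)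
  then have "invertible (diag_matrix \<epsilon>)" "matrix_inv (diag_matrix \<epsilon>) = diag_matrix \<epsilon>"
    unfolding invertible_right_inverse by (blast, rule matrix_inv_eqI)
  then show ?thesis
    using A(1)[OF U_pos[OF assms]] B(1)[OF U_pos[OF assms]] \<gamma>(3) assms
    by (simp add: G_eq matrix_inv_block_diag invertible_scaleR)
qed

lemma \<gamma>_differentiable: "y \<in> D \<Longrightarrow> (\<lambda>z. \<gamma> z $ p $ q) differentiable at (proj_right y)"
  using partial_differentiable(1)[OF V _ \<gamma>(1)] by simp

lemma partial_G:
  assumes y: "y \<in> D"
  shows "partial (Inl l) (\<lambda>y. G y $ Inl i $ Inl j) y = (if i = j then 2 * k * \<alpha> $ l * A (U y) / U y * \<epsilon> i else 0)"
    and "partial (Inr c) (\<lambda>y. G y $ Inl i $ Inl j) y = 0"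
    and "partial s (\<lambda>y. G y $ Inl i $ Inr a) y = 0"
    and "partial s (\<lambda>y. G y $ Inr a $ Inl i) y = 0"
    and "partial (Inl l) (\<lambda>y. G y $ Inr a $ Inr a') y = - 2 * \<alpha> $ l * B (U y) / U y * \<gamma> (proj_right y) $ a $ a'"
    and "partial (Inr c) (\<lambda>y. G y $ Inr a $ Inr a') y = B (U y) * partial c (\<lambda>z. \<gamma> z $ a $ a') (proj_right y)"
proof -
  note cong = partial_cong[OF open_D y]
  have "partial s (\<lambda>y. G y $ Inl i $ Inl j) y = partial s (\<lambda>y. A (U y) * (if i = j then \<epsilon> i else 0)) y" for s
    by (rule cong) (simp add: G_eq diag_matrix_def)
  then show "partial (Inl l) (\<lambda>y. G y $ Inl i $ Inl j) y = (if i = j then 2 * k * \<alpha> $ l * A (U y) / U y * \<epsilon> i else 0)"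
    "partial (Inr c) (\<lambda>y. G y $ Inl i $ Inl j) y = 0"
    using N by (simp_all only: partial_base[OF A(2)[OF U_pos[OF y]]]) simp_all
  have "partial s (\<lambda>y. G y $ Inl i $ Inr a) y = partial s (\<lambda>y. 0) y"
    by (rule cong) (simp add: G_eq)
  then show "partial s (\<lambda>y. G y $ Inl i $ Inr a) y = 0" by simp
  have "partial s (\<lambda>y. G y $ Inr a $ Inl i) y = partial s (\<lambda>y. 0) y"
    by (rule cong) (simp add: G_eq)
  then show "partial s (\<lambda>y. G y $ Inr a $ Inl i) y = 0" by simp
  have "partial s (\<lambda>y. G y $ Inr a $ Inr a') y = partial s (\<lambda>y. B (U y) * (\<lambda>z. \<gamma> z $ a $ a') (proj_right y)) y" for s
    by (rule cong) (simp add: G_eq)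
  then show "partial (Inl l) (\<lambda>y. G y $ Inr a $ Inr a') y = - 2 * \<alpha> $ l * B (U y) / U y * \<gamma> (proj_right y) $ a $ a'"
    "partial (Inr c) (\<lambda>y. G y $ Inr a $ Inr a') y = B (U y) * partial c (\<lambda>z. \<gamma> z $ a $ a') (proj_right y)"
    using N by (simp_all only: partial_separable[OF B(2)[OF U_pos[OF y]] \<gamma>_differentiable[OF y]]) simp_all
qed

section \<open>Christoffel symbols of the product and their contractions\<close>

text \<open>The Christoffel symbols of the base metric are those of a conformally flat metric whose
  conformal factor has logarithmic differential \<open>2 k / u \<cdot> \<alpha>\<close>.\<close>
definition K :: "'n \<Rightarrow> 'n \<Rightarrow> 'n \<Rightarrow> real" where
  "K l i j = (if l = i then \<alpha> $ j else 0) + (if l = j then \<alpha> $ i else 0)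
     - (if i = j then \<epsilon> i * \<epsilon> l * \<alpha> $ l else 0)"

text \<open>Radial factor of the fiber symbols with upper base index: raising the index of -(1/2)
  d_l B with the base metric gives \<open>\<epsilon> l * \<alpha> $ l\<close> times this, since d_l
  B = -2 \<alpha>_l B / u.\<close>

definition Q :: "real \<Rightarrow> real" where "Q u = B u / (A u * u)"

text \<open>Logarithmic derivatives add; in units of 1/u they are -2/N from \<open>B\<close>, -2k/N
  from 1/A and -1 from 1/u.\<close>

lemma Q_derivative:
  assumes "u > 0"
  shows "(Q has_real_derivative - (2 + 2 * k + N) / N * Q u / u) (at u)"
proof -
  have "A u \<noteq> 0" using A(1)[OF assms] by simp
  then have "((\<lambda>u. B u / (A u * u)) has_real_derivative - (2 + 2 * k + N) / N * (B u / (A u * u)) / u) (at u)"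
    using assms N
    by (auto intro!: derivative_eq_intros A(2) B(2) simp: field_simps)
  then show ?thesis by (simp add: Q_def[abs_def])
qed

text \<open>The inverse metric is block diagonal, so an upper base index involves base entries only
  and an upper fiber index fiber entries only. In the pure fiber symbols \<open>B\<close> cancels,
  being constant along the fiber; the mixed ones are half the logarithmic derivative of
  \<open>B\<close>.\<close>

lemma christoffel_G:
  assumes y: "y \<in> D"
  shows "christoffel G (Inl l) (Inl i) (Inl j) y = k / U y * K l i j"
    and "christoffel G (Inr c) (Inl i) (Inr a) y = (if c = a then - \<alpha> $ i / U y else 0)"
    and "christoffel G (Inr c) (Inr a) (Inl i) y = (if c = a then - \<alpha> $ i / U y else 0)"
    and "christoffel G (Inl l) (Inr a) (Inr a') y = Q (U y) * (\<epsilon> l * \<alpha> $ l * \<gamma> (proj_right y) $ a $ a')"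
    and "christoffel G (Inr c) (Inr a) (Inr a') y = christoffel \<gamma> c a a' (proj_right y)"
    and "christoffel G (Inr c) (Inl i) (Inl j) y = 0"
    and "christoffel G (Inl l) (Inl i) (Inr a) y = 0"
    and "christoffel G (Inl l) (Inr a) (Inl i) y = 0"
proof -
  have A0: "A (U y) \<noteq> 0" "B (U y) \<noteq> 0" "U y \<noteq> 0"
    using A(1)[OF U_pos[OF y]] B(1)[OF U_pos[OF y]] U_pos[OF y] by auto
  \<comment> \<open>The sum runs over the second index of \<gamma>; symmetry turns it into a matrix
    product.\<close>
  have i: "(\<Sum>a''\<in>UNIV. matrix_inv (\<gamma> (proj_right y)) $ c $ a'' * \<gamma> (proj_right y) $ a $ a'') = (if c = a then 1 else 0)" for c a
  proof -
    have s: "\<gamma> (proj_right y) $ a $ a'' = \<gamma> (proj_right y) $ a'' $ a" for a''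
      using \<gamma>(2)[of "proj_right y"] y by (simp add: vec_eq_iff transpose_def)
    have "(matrix_inv (\<gamma> (proj_right y)) ** \<gamma> (proj_right y)) $ c $ a = (if c = a then 1 else 0)"
      using matrix_inv_mult(2)[OF \<gamma>(3)] y by (simp add: mat_def)
    then show ?thesis by (simp add: matrix_matrix_mult_def s)
  qed
  have L: "christoffel G (Inl l) p q y = \<epsilon> l / (2 * A (U y)) * (partial p (\<lambda>z. G z $ q $ Inl l) y +
      partial q (\<lambda>z. G z $ p $ Inl l) y - partial (Inl l) (\<lambda>z. G z $ p $ q) y)" for l p q
    by (simp add: christoffel_def sum_UNIV_sum matrix_inv_G[OF y] diag_matrix_def
        if_distrib[of "\<lambda>x. _ * x"] if_distrib[of "\<lambda>x. x * _"] cong: if_cong)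
  have R: "christoffel G (Inr c) p q y = (\<Sum>a\<in>UNIV. matrix_inv (\<gamma> (proj_right y)) $ c $ a *
      (partial p (\<lambda>z. G z $ q $ Inr a) y + partial q (\<lambda>z. G z $ p $ Inr a) y
        - partial (Inr a) (\<lambda>z. G z $ p $ q) y)) / (2 * B (U y))" for c p q
    by (simp add: christoffel_def sum_UNIV_sum matrix_inv_G[OF y] sum_divide_distrib sum_distrib_left)
  show "christoffel G (Inl l) (Inl i) (Inl j) y = k / U y * K l i j"
    using A0 \<epsilon>[of l] by (auto simp: L partial_G[OF y] K_def field_simps)
  have "(\<Sum>a''\<in>UNIV. matrix_inv (\<gamma> (proj_right y)) $ c $ a'' * (- 2 * \<alpha> $ i * B (U y) / U y * \<gamma> (proj_right y) $ a $ a''))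
      = - 2 * \<alpha> $ i * B (U y) / U y * (if c = a then 1 else 0)" for c a i
    unfolding i[symmetric] sum_distrib_left by (simp add: ac_simps)
  then show "christoffel G (Inr c) (Inl i) (Inr a) y = (if c = a then - \<alpha> $ i / U y else 0)"
    "christoffel G (Inr c) (Inr a) (Inl i) y = (if c = a then - \<alpha> $ i / U y else 0)"
    unfolding R partial_G[OF y] using A0 by simp_all
  show "christoffel G (Inl l) (Inr a) (Inr a') y = Q (U y) * (\<epsilon> l * \<alpha> $ l * \<gamma> (proj_right y) $ a $ a')"
    using A0 by (auto simp: L partial_G[OF y] Q_def field_simps)
  show "christoffel G (Inr c) (Inr a) (Inr a') y = christoffel \<gamma> c a a' (proj_right y)"
    using A0 by (simp add: R partial_G[OF y] christoffel_def[of \<gamma>] sum_distrib_left sum_divide_distrib)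
      (intro sum.cong refl, simp add: field_simps)
  show "christoffel G (Inr c) (Inl i) (Inl j) y = 0"
    "christoffel G (Inl l) (Inl i) (Inr a) y = 0"
    "christoffel G (Inl l) (Inr a) (Inl i) y = 0"
    by (simp_all add: L R partial_G[OF y])
qed

text \<open>These are the contractions of base symbols that occur in the Ricci tensor. In the trace
  the last two parts of \<open>K\<close> cancel because each \<epsilon> i squares to 1.\<close>

lemma sum_K:
  "(\<Sum>l\<in>UNIV. K l l i) = real CARD('n) * \<alpha> $ i"
  "(\<Sum>l\<in>UNIV. \<alpha> $ l * K l i j) = 2 * \<alpha> $ i * \<alpha> $ j - (if i = j then \<epsilon> i * E else 0)"
  "(\<Sum>l\<in>UNIV. \<Sum>s\<in>UNIV. K l i s * K s l j) =
     (real CARD('n) + 2) * \<alpha> $ i * \<alpha> $ j - 2 * (if i = j then \<epsilon> i * E else 0)"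
proof -
  note if_distribs = if_distrib[of "\<lambda>x. _ * x"] if_distrib[of "\<lambda>x. x * _"]
  have K1: "(\<Sum>l\<in>UNIV. K l l i) = real CARD('n) * \<alpha> $ i" for i
    by (simp add: K_def sum.distrib sum_subtractf mult.assoc \<epsilon> flip: mult.assoc cong: if_cong)
  then show "(\<Sum>l\<in>UNIV. K l l i) = real CARD('n) * \<alpha> $ i" .
  have E': "(\<Sum>l\<in>UNIV. \<alpha> $ l * (\<epsilon> i * (\<epsilon> l * \<alpha> $ l))) = \<epsilon> i * E" for i
    unfolding E[symmetric] sum_distrib_left by (simp add: power2_eq_square ac_simps)
  have K2: "(\<Sum>l\<in>UNIV. \<alpha> $ l * K l i j) = 2 * \<alpha> $ i * \<alpha> $ j - (if i = j then \<epsilon> i * E else 0)" for i j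
  proof -
    have "(\<Sum>l\<in>UNIV. \<alpha> $ l * K l i j) = (\<Sum>l\<in>UNIV. if l = i then \<alpha> $ i * \<alpha> $ j else 0) +
        (\<Sum>l\<in>UNIV. if l = j then \<alpha> $ i * \<alpha> $ j else 0) - (if i = j then (\<Sum>l\<in>UNIV. \<alpha> $ l * (\<epsilon> i * (\<epsilon> l * \<alpha> $ l))) else 0)"
      by (simp add: K_def algebra_simps sum.distrib sum_subtractf if_distribs cong: if_cong)
    then show ?thesis by (simp add: E')
  qed
  then show "(\<Sum>l\<in>UNIV. \<alpha> $ l * K l i j) = 2 * \<alpha> $ i * \<alpha> $ j - (if i = j then \<epsilon> i * E else 0)" .
  \<comment> \<open>The first and third parts cancel after summation; the part with i = j adds up to
    \<open>E\<close>.\<close>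
  have K4: "(\<Sum>l\<in>UNIV. \<epsilon> i * \<epsilon> l * \<alpha> $ l * K i l j) = (if i = j then \<epsilon> i * E else 0)"
  proof -
    have "\<epsilon> i * \<epsilon> l * \<alpha> $ l * K i l j = (if l = i then \<alpha> $ i * \<alpha> $ j else 0)
       + (if i = j then \<epsilon> i * (\<epsilon> l * (\<alpha> $ l)\<^sup>2) else 0) - (if l = j then \<alpha> $ i * \<alpha> $ j else 0)" for l
      using \<epsilon>[of l] \<epsilon>[of i] by (auto simp: K_def power2_eq_square algebra_simps)
    then show ?thesis
      by (simp add: sum.distrib sum_subtractf E sum_distrib_left[symmetric] cong: if_cong)
  qed
  \<comment> \<open>Only the first factor is expanded. Its three deltas reduce the double sum to the
    pairing with \<alpha>, the trace, and the contraction \<open>K4\<close>.\<close>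
  have "(\<Sum>s\<in>UNIV. K l i s * K s l j) = (if l = i then 2 * \<alpha> $ l * \<alpha> $ j - (if l = j then \<epsilon> l * E else 0) else 0)
      + \<alpha> $ i * K l l j - \<epsilon> i * \<epsilon> l * \<alpha> $ l * K i l j" for l
  proof -
    have "K l i s * K s l j = (if l = i then \<alpha> $ s * K s l j else 0) + (if s = l then \<alpha> $ i * K l l j else 0)
        - (if s = i then \<epsilon> i * \<epsilon> l * \<alpha> $ l * K i l j else 0)" for s
      by (simp add: K_def[of l i s] algebra_simps)
    then show ?thesis by (simp add: sum.distrib sum_subtractf K2)
  qed
  then have "(\<Sum>l\<in>UNIV. \<Sum>s\<in>UNIV. K l i s * K s l j) =
      2 * \<alpha> $ i * \<alpha> $ j - (if i = j then \<epsilon> i * E else 0)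
      + \<alpha> $ i * (\<Sum>l\<in>UNIV. K l l j) - (\<Sum>l\<in>UNIV. \<epsilon> i * \<epsilon> l * \<alpha> $ l * K i l j)"
    by (simp add: sum.distrib sum_subtractf sum_distrib_left)
  then show "(\<Sum>l\<in>UNIV. \<Sum>s\<in>UNIV. K l i s * K s l j) =
     (real CARD('n) + 2) * \<alpha> $ i * \<alpha> $ j - 2 * (if i = j then \<epsilon> i * E else 0)"
    unfolding K4 K1 by (simp add: algebra_simps)
qed

lemma partial_christoffel_G:
  assumes y: "y \<in> D"
  shows "partial (Inl p) (christoffel G (Inl l) (Inl i) (Inl j)) y = - N * k / (U y)\<^sup>2 * \<alpha> $ p * K l i j"
    and "partial (Inr c) (christoffel G (Inl l) (Inl i) (Inl j)) y = 0"
    and "partial (Inl p) (christoffel G (Inr c) (Inl i) (Inr a)) y = (if c = a then N / (U y)\<^sup>2 * \<alpha> $ p * \<alpha> $ i else 0)"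
    and "partial (Inr d) (christoffel G (Inr c) (Inl i) (Inr a)) y = 0"
    and "partial (Inl p) (christoffel G (Inr c) (Inr a) (Inl i)) y = (if c = a then N / (U y)\<^sup>2 * \<alpha> $ p * \<alpha> $ i else 0)"
    and "partial (Inr d) (christoffel G (Inr c) (Inr a) (Inl i)) y = 0"
    and "partial (Inl p) (christoffel G (Inl l) (Inr a) (Inr a')) y =
       - (2 + 2 * k + N) * Q (U y) / U y * \<alpha> $ p * (\<epsilon> l * \<alpha> $ l * \<gamma> (proj_right y) $ a $ a')"
    and "partial (Inl p) (christoffel G (Inr c) (Inr a) (Inr a')) y = 0"
    and "partial (Inr d) (christoffel G (Inr c) (Inr a) (Inr a')) y = partial d (christoffel \<gamma> c a a') (proj_right y)"
    and "partial s (christoffel G (Inr c) (Inl i) (Inl j)) y = 0"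
    and "partial s (christoffel G (Inl l) (Inl i) (Inr a)) y = 0"
    and "partial s (christoffel G (Inl l) (Inr a) (Inl i)) y = 0"
proof -
  note cong = partial_cong[OF open_D y]
  have U0: "U y \<noteq> 0" using U_pos[OF y] by simp
  have der: "((\<lambda>u. c / u) has_real_derivative - c / (U y)\<^sup>2) (at (U y))" for c
    using U0 by (auto intro!: derivative_eq_intros simp: power2_eq_square)
  have "partial s (christoffel G (Inl l) (Inl i) (Inl j)) y = partial s (\<lambda>y. k / U y * K l i j) y" for s
    by (rule cong) (simp only: christoffel_G)
  then show "partial (Inl p) (christoffel G (Inl l) (Inl i) (Inl j)) y = - N * k / (U y)\<^sup>2 * \<alpha> $ p * K l i j"
    "partial (Inr c) (christoffel G (Inl l) (Inl i) (Inl j)) y = 0"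
    by (simp_all only: partial_base[OF der]) simp_all
  have "partial s (christoffel G (Inr c) (Inl i) (Inr a)) y = partial s (\<lambda>y. 1 / U y * (if c = a then - \<alpha> $ i else 0)) y" for s
    by (rule cong) (simp add: christoffel_G)
  then show "partial (Inl p) (christoffel G (Inr c) (Inl i) (Inr a)) y = (if c = a then N / (U y)\<^sup>2 * \<alpha> $ p * \<alpha> $ i else 0)"
    "partial (Inr d) (christoffel G (Inr c) (Inl i) (Inr a)) y = 0"
    by (simp_all only: partial_base[OF der]) simp_all
  have "partial s (christoffel G (Inr c) (Inr a) (Inl i)) y = partial s (\<lambda>y. 1 / U y * (if c = a then - \<alpha> $ i else 0)) y" for s
    by (rule cong) (simp add: christoffel_G)
  then show "partial (Inl p) (christoffel G (Inr c) (Inr a) (Inl i)) y = (if c = a then N / (U y)\<^sup>2 * \<alpha> $ p * \<alpha> $ i else 0)"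
    "partial (Inr d) (christoffel G (Inr c) (Inr a) (Inl i)) y = 0"
    by (simp_all only: partial_base[OF der]) simp_all
  have "partial s (christoffel G (Inl l) (Inr a) (Inr a')) y =
      partial s (\<lambda>y. Q (U y) * (\<lambda>z. \<epsilon> l * \<alpha> $ l * \<gamma> z $ a $ a') (proj_right y)) y" for s
    by (rule cong) (simp add: christoffel_G)
  moreover have v: "(\<lambda>z. \<epsilon> l * \<alpha> $ l * \<gamma> z $ a $ a') differentiable (at (proj_right y))"
    by (intro differentiable_mult \<gamma>_differentiable[OF y]) auto
  ultimately show "partial (Inl p) (christoffel G (Inl l) (Inr a) (Inr a')) y =
       - (2 + 2 * k + N) * Q (U y) / U y * \<alpha> $ p * (\<epsilon> l * \<alpha> $ l * \<gamma> (proj_right y) $ a $ a')"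
    using N U0 by (simp only: partial_separable(1)[OF Q_derivative[OF U_pos[OF y]] v]) (simp add: divide_simps)
  have "partial s (christoffel G (Inr c) (Inr a) (Inr a')) y = partial s (\<lambda>y. christoffel \<gamma> c a a' (proj_right y)) y" for s
    by (rule cong) (simp only: christoffel_G)
  moreover have "christoffel \<gamma> c a a' differentiable (at (proj_right y))"
    using y by (intro christoffel_differentiable[OF V _ \<gamma>(1,3)]) auto
  ultimately show "partial (Inl p) (christoffel G (Inr c) (Inr a) (Inr a')) y = 0"
    "partial (Inr d) (christoffel G (Inr c) (Inr a) (Inr a')) y = partial d (christoffel \<gamma> c a a') (proj_right y)"
    by (simp_all only: partial_fiber)
  have "partial s (christoffel G (Inr c) (Inl i) (Inl j)) y = partial s (\<lambda>y. 0) y"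
    by (rule cong) (simp only: christoffel_G)
  then show "partial s (christoffel G (Inr c) (Inl i) (Inl j)) y = 0" by simp
  have "partial s (christoffel G (Inl l) (Inl i) (Inr a)) y = partial s (\<lambda>y. 0) y"
    by (rule cong) (simp only: christoffel_G)
  then show "partial s (christoffel G (Inl l) (Inl i) (Inr a)) y = 0" by simp
  have "partial s (christoffel G (Inl l) (Inr a) (Inl i)) y = partial s (\<lambda>y. 0) y"
    by (rule cong) (simp only: christoffel_G)
  then show "partial s (christoffel G (Inl l) (Inr a) (Inl i)) y = 0" by simp
qed

text \<open>The contracted symbol is the logarithmic derivative of the volume density: each base
  direction contributes k \<alpha>_i / u and each fiber direction -\<alpha>_i / u, while fiber
  derivatives see the density of \<gamma> alone.\<close>

lemma christoffel_trace:
  assumes y: "y \<in> D"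
  shows "(\<Sum>l\<in>UNIV. christoffel G l l (Inl i) y) = (k * real CARD('n) - real CARD('m)) / U y * \<alpha> $ i"
    and "(\<Sum>l\<in>UNIV. christoffel G l l (Inr a) y) = (\<Sum>c\<in>UNIV. christoffel \<gamma> c c a (proj_right y))"
proof -
  have "(\<Sum>l\<in>UNIV. christoffel G (Inl l) (Inl l) (Inl i) y) = k / U y * (\<Sum>l\<in>UNIV. K l l i)"
    by (simp only: christoffel_G[OF y] sum_distrib_left)
  then show "(\<Sum>l\<in>UNIV. christoffel G l l (Inl i) y) = (k * real CARD('n) - real CARD('m)) / U y * \<alpha> $ i"
    by (simp add: sum_UNIV_sum christoffel_G(3)[OF y] sum_K(1) left_diff_distrib right_diff_distrib diff_divide_distrib mult.commute)
  show "(\<Sum>l\<in>UNIV. christoffel G l l (Inr a) y) = (\<Sum>c\<in>UNIV. christoffel \<gamma> c c a (proj_right y))"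
    by (simp add: sum_UNIV_sum christoffel_G[OF y])
qed

section \<open>The Ricci tensor, block by block\<close>

lemma ricci_base:
  assumes y: "y \<in> D"
  shows "ricci_coord G y $ Inl i $ Inl j =
     ((real CARD('n) - 2) * k * N - real CARD('m) * N + (real CARD('n) - 2) * k\<^sup>2
        - 2 * k * real CARD('m) - real CARD('m)) * \<alpha> $ i * \<alpha> $ j / (U y)\<^sup>2
     + k * (N + real CARD('m) - (real CARD('n) - 2) * k) / (U y)\<^sup>2 * (if i = j then \<epsilon> i * E else 0)"
proof -
  let ?n = "real CARD('n)" and ?m = "real CARD('m)"
  let ?d = "if i = j then \<epsilon> i * E else 0"
  have U0: "U y \<noteq> 0" using U_pos[OF y] by simp
  have 1: "(\<Sum>l\<in>UNIV. partial l (christoffel G l (Inl i) (Inl j)) y) = - N * k / (U y)\<^sup>2 * (2 * \<alpha> $ i * \<alpha> $ j - ?d)"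
    by (simp only: sum_UNIV_sum partial_christoffel_G[OF y] mult.assoc sum_distrib_left[symmetric] sum_K(2)) simp
  have 2: "(\<Sum>l\<in>UNIV. partial (Inl i) (christoffel G l l (Inl j)) y) = - N * k / (U y)\<^sup>2 * \<alpha> $ i * (?n * \<alpha> $ j) + ?m * (N / (U y)\<^sup>2 * \<alpha> $ i * \<alpha> $ j)"
    by (simp only: sum_UNIV_sum partial_christoffel_G[OF y] sum_distrib_left[symmetric] sum_K(1)) simp
  have 3: "(\<Sum>s\<in>UNIV. (\<Sum>l\<in>UNIV. christoffel G l l s y) * christoffel G s (Inl i) (Inl j) y)
      = (k * ?n - ?m) * k / (U y)\<^sup>2 * (2 * \<alpha> $ i * \<alpha> $ j - ?d)"
    unfolding sum_K(2)[symmetric] sum_distrib_left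
    by (subst sum_UNIV_sum) (simp add: christoffel_trace[OF y] christoffel_G[OF y] power2_eq_square ac_simps)
  \<comment> \<open>The last summand comes from the mixed symbols: for each of the m fiber indices,
    the product of -\<alpha>_i / u and -\<alpha>_j / u.\<close>
  have 4: "(\<Sum>l\<in>UNIV. \<Sum>s\<in>UNIV. christoffel G l (Inl i) s y * christoffel G s l (Inl j) y)
      = k\<^sup>2 / (U y)\<^sup>2 * ((?n + 2) * \<alpha> $ i * \<alpha> $ j - 2 * ?d) + ?m * (\<alpha> $ i * \<alpha> $ j / (U y)\<^sup>2)"
    unfolding sum_K(3)[symmetric] sum_distrib_left
    by (simp add: sum_UNIV_sum christoffel_G[OF y] power2_eq_square ac_simps
        if_distrib[of "\<lambda>x. _ * x"] if_distrib[of "\<lambda>x. x * _"] cong: if_cong)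
  show ?thesis
    unfolding ricci_coord_eq 1 2 3 4 using U0 by (simp add: field_simps power2_eq_square)
qed

text \<open>All derivative terms vanish. The trace term and the quadratic term both equal
  -\<alpha>_i / u times the contracted fiber symbol, and cancel. With the fiber index first, the
  quadratic term contracts the other lower index, and the symmetry of the symbols is called
  for.\<close>

lemma ricci_mixed:
  assumes y: "y \<in> D"
  shows "ricci_coord G y $ Inl i $ Inr a = 0" "ricci_coord G y $ Inr a $ Inl i = 0"
proof -
  have c: "christoffel \<gamma> c a a' (proj_right y) = christoffel \<gamma> c a' a (proj_right y)" for c a a'
    using christoffel_commute[OF V _ \<gamma>(2)] y by simp
  note d = ricci_coord_eq christoffel_trace[OF y] sum_UNIV_sum christoffel_G[OF y] partial_christoffel_G[OF y]
      if_distrib[of "\<lambda>x. _ * x"] if_distrib[of "\<lambda>x. x * _"]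
  show "ricci_coord G y $ Inl i $ Inr a = 0"
    by (simp add: d sum_distrib_right sum_distrib_left mult.commute cong: if_cong)
  show "ricci_coord G y $ Inr a $ Inl i = 0"
    by (simp add: d sum_distrib_right sum_distrib_left mult.commute c[of _ a] cong: if_cong)
qed

text \<open>Pure fiber terms reassemble into the Ricci tensor of \<gamma>. Terms through a base
  index are multiples of E Q \<gamma> / u, with the coefficients -(2 + 2k + N) from the divergence,
  k n - m from the trace term and 2 from the quadratic term.\<close>

lemma ricci_fiber:
  assumes y: "y \<in> D"
  shows "ricci_coord G y $ Inr a $ Inr a' = ricci_coord \<gamma> (proj_right y) $ a $ a' +
     E * (k * real CARD('n) - real CARD('m) - 2 * k - N) * Q (U y) / U y * \<gamma> (proj_right y) $ a $ a'"
proof -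
  let ?n = "real CARD('n)" and ?m = "real CARD('m)" and ?z = "proj_right y"
  have 1: "(\<Sum>l\<in>UNIV. partial l (christoffel G l (Inr a) (Inr a')) y) =
      - (2 + 2 * k + N) * Q (U y) / U y * E * \<gamma> ?z $ a $ a' + (\<Sum>l\<in>UNIV. partial l (christoffel \<gamma> l a a') ?z)"
    unfolding E[symmetric] sum_distrib_left sum_distrib_right
    by (simp add: sum_UNIV_sum partial_christoffel_G[OF y] power2_eq_square ac_simps)
  have 2: "(\<Sum>l\<in>UNIV. partial (Inr a) (christoffel G l l (Inr a')) y) = (\<Sum>l\<in>UNIV. partial a (christoffel \<gamma> l l a') ?z)"
    by (simp add: sum_UNIV_sum partial_christoffel_G[OF y])
  have 3: "(\<Sum>s\<in>UNIV. (\<Sum>l\<in>UNIV. christoffel G l l s y) * christoffel G s (Inr a) (Inr a') y)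
      = (k * ?n - ?m) / U y * Q (U y) * E * \<gamma> ?z $ a $ a'
        + (\<Sum>s\<in>UNIV. (\<Sum>l\<in>UNIV. christoffel \<gamma> l l s ?z) * christoffel \<gamma> s a a' ?z)"
    unfolding E[symmetric] sum_distrib_left[of "(k * ?n - ?m) / U y * Q (U y)"]
      sum_distrib_right[of _ _ "\<gamma> ?z $ a $ a'"]
    by (subst sum_UNIV_sum) (simp add: christoffel_trace[OF y] christoffel_G[OF y] power2_eq_square ac_simps)
  have 4: "(\<Sum>l\<in>UNIV. \<Sum>s\<in>UNIV. christoffel G l (Inr a) s y * christoffel G s l (Inr a') y)
      = - 2 * Q (U y) / U y * E * \<gamma> ?z $ a $ a'
       + (\<Sum>l\<in>UNIV. \<Sum>s\<in>UNIV. christoffel \<gamma> l a s ?z * christoffel \<gamma> s l a' ?z)"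
  proof -
    have 5: "(\<Sum>i\<in>UNIV. - \<alpha> $ i / U y * (Q (U y) * (\<epsilon> i * \<alpha> $ i * \<gamma> ?z $ a $ a'))) = - Q (U y) / U y * E * \<gamma> ?z $ a $ a'"
      unfolding E[symmetric] sum_distrib_left sum_distrib_right
      by (simp add: power2_eq_square ac_simps)
    have 6: "(\<Sum>c\<in>UNIV. christoffel G (Inl i) (Inr a) (Inr c) y * christoffel G (Inr c) (Inl i) (Inr a') y)
        = - \<alpha> $ i / U y * (Q (U y) * (\<epsilon> i * \<alpha> $ i * \<gamma> ?z $ a $ a'))" for i
      by (simp add: christoffel_G[OF y] if_distrib[of "\<lambda>x. _ * x"] cong: if_cong)
    \<comment> \<open>The other mixed order of indices: after exchanging the sums it contributes as
      much as \<open>6\<close> summed over i, whence the factor 2.\<close>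
    have "(\<Sum>c\<in>UNIV. \<Sum>i\<in>UNIV. christoffel G (Inr c) (Inr a) (Inl i) y * christoffel G (Inl i) (Inr c) (Inr a') y)
       = (\<Sum>i\<in>UNIV. - \<alpha> $ i / U y * (Q (U y) * (\<epsilon> i * \<alpha> $ i * \<gamma> ?z $ a $ a')))"
      by (subst sum.swap) (simp add: christoffel_G[OF y] if_distrib[of "\<lambda>x. x * _"] cong: if_cong)
    then show ?thesis
      by (simp only: sum_UNIV_sum sum.distrib 6) (simp only: 5 christoffel_G[OF y], simp)
  qed
  show ?thesis
    unfolding ricci_coord_eq 1 2 3 4 using U_pos[OF y] by (simp add: field_simps)
qed

section \<open>The Hessian of the potential and the soliton equation\<close>

lemma hessian_G:
  assumes y: "y \<in> D" and h: "\<forall>y\<in>D. h y = - (H / N) * ln (U y)"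
  shows "hessian_coord G h y $ Inl i $ Inl j = H * (N + 2 * k) * \<alpha> $ i * \<alpha> $ j / (U y)\<^sup>2
      - k * H / (U y)\<^sup>2 * (if i = j then \<epsilon> i * E else 0)"
    and "hessian_coord G h y $ Inl i $ Inr a = 0"
    and "hessian_coord G h y $ Inr a $ Inl i = 0"
    and "hessian_coord G h y $ Inr a $ Inr a' = E * H * Q (U y) / U y * \<gamma> (proj_right y) $ a $ a'"
proof -
  note cong = partial_cong[OF open_D]
  have U0: "U y \<noteq> 0" using U_pos[OF y] by simp
  have d: "partial s h y = partial s (\<lambda>y. ln (U y) * (- (H / N))) y" if "y \<in> D" for s y
    by (rule cong[OF that]) (simp add: h)
  \<comment> \<open>Stated for every point of \<open>D\<close>, since second derivatives require the
    first ones on a neighbourhood.\<close>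
  have p: "partial (Inl i) h y = 1 / U y * (- H * \<alpha> $ i)" "partial (Inr a) h y = 0" if y: "y \<in> D" for i a y
    using N by (simp_all only: d[OF y] partial_base[OF DERIV_ln_divide[OF U_pos[OF y]]]) simp_all
  have der: "((\<lambda>u. 1 / u) has_real_derivative - 1 / (U y)\<^sup>2) (at (U y))"
    using U0 by (auto intro!: derivative_eq_intros simp: power2_eq_square)
  have "partial s (partial (Inl i) h) y = partial s (\<lambda>y. 1 / U y * (- H * \<alpha> $ i)) y" for s i
    by (rule cong[OF y]) (rule p)
  then have pp: "partial (Inl j) (partial (Inl i) h) y = N * H * \<alpha> $ i * \<alpha> $ j / (U y)\<^sup>2"
    "partial (Inr a) (partial (Inl i) h) y = 0" for i j a
    by (simp_all only: partial_base[OF der]) simp_all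
  have "partial s (partial (Inr a) h) y = partial s (\<lambda>y. 0) y" for s a
    by (rule cong[OF y]) (rule p)
  then have p0: "partial s (partial (Inr a) h) y = 0" for s a by simp
  have S: "(\<Sum>l\<in>UNIV. christoffel G (Inl l) (Inl i) (Inl j) y * partial (Inl l) h y)
      = - H * k / (U y)\<^sup>2 * (2 * \<alpha> $ i * \<alpha> $ j - (if i = j then \<epsilon> i * E else 0))"
    unfolding sum_K(2)[symmetric] sum_distrib_left
    by (simp add: christoffel_G[OF y] p[OF y] power2_eq_square ac_simps)
  show "hessian_coord G h y $ Inl i $ Inl j = H * (N + 2 * k) * \<alpha> $ i * \<alpha> $ j / (U y)\<^sup>2
      - k * H / (U y)\<^sup>2 * (if i = j then \<epsilon> i * E else 0)"
    unfolding hessian_coord_def vec_lambda_beta sum_UNIV_sum S pp p(2)[OF y]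
    using U0 by (simp add: field_simps)
  show "hessian_coord G h y $ Inl i $ Inr a = 0" "hessian_coord G h y $ Inr a $ Inl i = 0"
    by (simp_all add: hessian_coord_def sum_UNIV_sum pp p0 p[OF y] christoffel_G[OF y])
  \<comment> \<open>Although \<open>h\<close> is constant along the fiber, its Hessian has a fiber
    block: the base components of the fiber symbols meet the derivative of \<open>h\<close>.\<close>
  have S: "(\<Sum>l\<in>UNIV. christoffel G (Inl l) (Inr a) (Inr a') y * partial (Inl l) h y)
      = - (E * H * Q (U y) / U y * \<gamma> (proj_right y) $ a $ a')"
    unfolding E[symmetric] sum_distrib_right sum_divide_distrib
    by (simp add: christoffel_G[OF y] p[OF y] power2_eq_square sum_negf ac_simps)
  show "hessian_coord G h y $ Inr a $ Inr a' = E * H * Q (U y) / U y * \<gamma> (proj_right y) $ a $ a'"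
    unfolding hessian_coord_def vec_lambda_beta sum_UNIV_sum S p0 p(2)[OF y] by simp
qed

text \<open>The choice of \<open>H\<close> alone cancels the metric parts of both blocks;
  \<open>quad\<close> enters through \<open>c\<close>, the coefficient of the product of two
  components of \<alpha>.\<close>

lemma ricci_plus_hessian:
  assumes y: "y \<in> D" and h: "\<forall>y\<in>D. h y = - (H / N) * ln (U y)"
    and H: "H = real CARD('m) - (real CARD('n) - 2) * k + N"
    and quad: "N\<^sup>2 + 2 * k * N = real CARD('m) + k\<^sup>2 * (real CARD('n) - 2)"
    and flat: "ricci_coord \<gamma> (proj_right y) = 0"
  shows "ricci_coord G y + hessian_coord G h y = 0"
proof -
  have c: "(real CARD('n) - 2) * k * N - real CARD('m) * N + (real CARD('n) - 2) * k\<^sup>2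
        - 2 * k * real CARD('m) - real CARD('m) + H * (N + 2 * k) = 0"
    using quad unfolding H by (simp add: algebra_simps power2_eq_square)
  have "ricci_coord G y $ Inl i $ Inl j + hessian_coord G h y $ Inl i $ Inl j = 0" for i j
  proof -
    have "ricci_coord G y $ Inl i $ Inl j + hessian_coord G h y $ Inl i $ Inl j =
      ((real CARD('n) - 2) * k * N - real CARD('m) * N + (real CARD('n) - 2) * k\<^sup>2
        - 2 * k * real CARD('m) - real CARD('m) + H * (N + 2 * k)) * \<alpha> $ i * \<alpha> $ j / (U y)\<^sup>2"
      unfolding ricci_base[OF y] hessian_G(1)[OF y h] by (simp add: H algebra_simps add_divide_distrib diff_divide_distrib)
    then show ?thesis unfolding c by simp
  qed
  moreover have "ricci_coord G y $ Inr a $ Inr a' + hessian_coord G h y $ Inr a $ Inr a' = 0" for a a'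
    unfolding ricci_fiber[OF y] hessian_G(4)[OF y h] flat H by (simp add: algebra_simps add_divide_distrib diff_divide_distrib)
  ultimately show ?thesis
    by (simp add: vec_eq_iff split_sum_all ricci_mixed[OF y] hessian_G(2,3)[OF y h])
qed

end

section \<open>The half space with its conformal metric\<close>

lemma second_countable_euclidean:
  "second_countable (euclidean :: 'a::second_countable_topology topology)"
proof -
  obtain \<B> :: "'a set set" where "countable \<B>" "\<And>C. C \<in> \<B> \<Longrightarrow> open C"
    "\<And>S. open S \<Longrightarrow> \<exists>U. U \<subseteq> \<B> \<and> S = \<Union>U"
    using univ_second_countable by metis
  then show ?thesis
    unfolding second_countable_def by (intro exI[of _ \<B>]) (simp, blast)
qed

lemma conformal_pseudo_euclidean_simps [simp]:
  "mtop (conformal_metric w (pseudo_euclidean \<epsilon> \<Omega>)) = top_of_set \<Omega>"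
  "atlas (conformal_metric w (pseudo_euclidean \<epsilon> \<Omega>)) = UNIV"
  "chart_dom (conformal_metric w (pseudo_euclidean \<epsilon> \<Omega>)) i = \<Omega>"
  "chart (conformal_metric w (pseudo_euclidean \<epsilon> \<Omega>)) i x = x"
  "metric (conformal_metric w (pseudo_euclidean \<epsilon> \<Omega>)) i x = w x *\<^sub>R diag_matrix \<epsilon>"
  "chart_img (conformal_metric w (pseudo_euclidean \<epsilon> \<Omega>)) i = \<Omega>"
  by (simp_all add: conformal_metric_def pseudo_euclidean_def chart_img_def)

lemma conformal_pseudo_euclidean_chart_inv [simp]:
  assumes "x \<in> \<Omega>"
  shows "chart_inv (conformal_metric w (pseudo_euclidean \<epsilon> \<Omega>)) i x = x"
proof -
  have "inv_into \<Omega> (\<lambda>x. x) x = x" by (rule inv_into_f_eq) (use assms in auto)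
  then show ?thesis
    by (simp add: conformal_metric_def pseudo_euclidean_def chart_inv_def)
qed

lemma smooth_function_conformal_pseudo_euclidean:
  assumes "open \<Omega>" "smooth_on \<Omega> u"
  shows "smooth_function (conformal_metric w (pseudo_euclidean \<epsilon> \<Omega>)) u"
  unfolding smooth_function_def
proof
  fix i
  show "smooth_on (chart_img (conformal_metric w (pseudo_euclidean \<epsilon> \<Omega>)) i)
      (u \<circ> chart_inv (conformal_metric w (pseudo_euclidean \<epsilon> \<Omega>)) i)"
    unfolding conformal_pseudo_euclidean_simps
    by (rule smooth_on_cong_imp[OF assms(1) _ assms(2)]) simp
qed

text \<open>With a single chart the compatibility condition says that the Jacobian is the identity.
  The standard basis is orthonormal for \<open>diag_matrix \<epsilon>\<close>, and the positive
  factor \<open>w\<close> keeps the index.\<close>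

lemma semi_riemannian_conformal_pseudo_euclidean:
  fixes \<epsilon> :: "'n::finite \<Rightarrow> real"
  assumes \<Omega>: "open \<Omega>" and \<epsilon>: "\<And>i. \<epsilon> i = 1 \<or> \<epsilon> i = -1"
    and w: "smooth_on \<Omega> w" "\<And>x. x \<in> \<Omega> \<Longrightarrow> w x > 0"
  shows "semi_riemannian_manifold (conformal_metric w (pseudo_euclidean \<epsilon> \<Omega>))"
proof -
  let ?M = "conformal_metric w (pseudo_euclidean \<epsilon> \<Omega>)"
  have chart: "chart ?M i = (\<lambda>x. x)" for i by (simp add: fun_eq_iff)
  have "smooth_on \<Omega> (chart ?M j \<circ> chart_inv ?M i)" for i j
    by (rule smooth_on_cong_imp[OF \<Omega> _ smooth_on_ident[OF \<Omega>]]) simp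
  moreover have "homeomorphic_map (top_of_set \<Omega>) (top_of_set \<Omega>) (\<lambda>x. x)"
    using homeomorphic_map_id[of "top_of_set \<Omega>" "top_of_set \<Omega>"] by (simp add: id_def)
  ultimately have "smooth_manifold ?M"
    using \<Omega> by (simp add: smooth_manifold_def chart Hausdorff_space_subtopology
        second_countable_subtopology
        second_countable_euclidean subtopology_subtopology)
  moreover have "smooth_on (chart_img ?M i) (metric ?M i \<circ> chart_inv ?M i)" for i
    unfolding conformal_pseudo_euclidean_simps
    by (rule smooth_on_cong_imp[OF \<Omega> _ smooth_on_bilinear[OF \<Omega> bounded_bilinear_scaleR w(1)
        smooth_on_const[OF \<Omega>, of "diag_matrix \<epsilon>"]]]) simp
  moreover have "jacobian (chart ?M j \<circ> chart_inv ?M i) (at x) = mat 1" if "x \<in> \<Omega>" for i j x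
  proof -
    have "((chart ?M j \<circ> chart_inv ?M i) has_derivative (\<lambda>v. v)) (at x)"
      by (rule has_derivative_transform_within_open[OF has_derivative_ident \<Omega> that]) simp
    from frechet_derivative_at[OF this] have "frechet_derivative (chart ?M j \<circ> chart_inv ?M i) (at x) = (\<lambda>v. v)"
      by simp
    then show ?thesis
      by (simp add: jacobian_def matrix_def mat_def vec_eq_iff axis_def)
  qed
  moreover have diag: "transpose (diag_matrix \<epsilon>) = diag_matrix \<epsilon>" "diag_matrix \<epsilon> ** diag_matrix \<epsilon> = mat 1"
    using \<epsilon> by (auto simp: vec_eq_iff transpose_def diag_matrix_def matrix_matrix_mult_def mat_def
        if_distrib[of "\<lambda>x. _ * x"] if_distrib[of "\<lambda>x. x * _"] cong: if_cong)
      (metis mult.right_neutral mult_minus1_right minus_minus)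
  then have inv: "invertible (diag_matrix \<epsilon>)" unfolding invertible_right_inverse by blast
  moreover have "has_index (metric ?M i x) (card {i. \<epsilon> i = -1})" if "x \<in> \<Omega>" for i x
  proof -
    have "has_index (diag_matrix \<epsilon>) (card {i. \<epsilon> i = -1})"
      unfolding has_index_def using \<epsilon>
      by (intro exI[of _ "mat 1"] exI[of _ \<epsilon>]) (simp add: invertible_def transpose_mat)
    then show ?thesis using has_index_scaleR w(2)[OF that] by simp
  qed
  moreover have "transpose (c *\<^sub>R diag_matrix \<epsilon>) = c *\<^sub>R diag_matrix \<epsilon>" for c
    using diag(1) by (simp add: vec_eq_iff transpose_def)
  moreover have "invertible (w x *\<^sub>R diag_matrix \<epsilon>)" if "x \<in> \<Omega>" for x
    using invertible_scaleR(1)[OF inv] w(2)[OF that] by simp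
  ultimately show ?thesis
    unfolding semi_riemannian_manifold_def Let_def
    by (auto simp: transpose_mat)
qed

theorem theorem1p4:
  fixes \<epsilon> :: "'n::finite \<Rightarrow> real" and \<alpha> :: "real^'n" and i\<^sub>0 :: 'n
    and n m :: nat and k c\<^sub>1 c\<^sub>2 b \<sigma> N :: real
    and \<xi> :: "real^'n \<Rightarrow> real" and \<phi> f h :: "real \<Rightarrow> real"
    and \<Omega> :: "(real^'n) set" and base :: "(real^'n, unit, 'n) charted_metric_space"
    and F :: "('q, 'j, 'm::finite) charted_metric_space"
  assumes "n = CARD('n)" and "n \<ge> 3" and "m = CARD('m)" and "m \<ge> 1"
    and "\<And>i. \<epsilon> i = 1 \<or> \<epsilon> i = -1"
    and "(\<Sum>i\<in>UNIV. \<epsilon> i * (\<alpha> $ i)\<^sup>2) = \<epsilon> i\<^sub>0"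
    and "k > 0" and "c\<^sub>1 > 0" and "c\<^sub>2 > 0"
    and "\<sigma> = 1 \<or> \<sigma> = -1"
    and "N = -k + \<sigma> * sqrt (real m + k\<^sup>2 * (real n - 1))"
    and "\<xi> = (\<lambda>x. \<Sum>i\<in>UNIV. \<alpha> $ i * x $ i)"
    and "\<phi> = (\<lambda>t. c\<^sub>2 / (N * t + b) powr (k / N))"
    and "f = (\<lambda>t. c\<^sub>1 / (N * t + b) powr (1 / N))"
    and "h = (\<lambda>t. - ((real m - (real n - 2) * k + N) / N) * ln (N * t + b))"
    and "\<Omega> = {x. N * \<xi> x + b > 0}"
    and "base = conformal_metric (\<lambda>x. 1 / (\<phi> (\<xi> x))\<^sup>2) (pseudo_euclidean \<epsilon> \<Omega>)"
    and "semi_riemannian_manifold F" and "ricci_flat F"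
  shows "semi_riemannian_manifold base \<and>
      warping_function base (\<lambda>x. f (\<xi> x)) \<and>
      steady_gradient_ricci_soliton (warped_product base (\<lambda>x. f (\<xi> x)) F) (\<lambda>(x, q). h (\<xi> x)) \<and>
      (\<sigma> = 1 \<longrightarrow>
        \<Omega> = {x. (\<Sum>i\<in>UNIV. \<alpha> $ i * x $ i) > - b / (- k + sqrt (real m + k\<^sup>2 * (real n - 1)))}) \<and>
      (\<sigma> = -1 \<longrightarrow>
        \<Omega> = {x. (\<Sum>i\<in>UNIV. \<alpha> $ i * x $ i) < - b / (- k - sqrt (real m + k\<^sup>2 * (real n - 1)))})"
proof -
  note n = assms(1,2) and m = assms(3,4) and \<epsilon> = assms(5) and unit = assms(6) and pos = assms(7-9)
    and \<sigma> = assms(10) and N = assms(11) and \<xi> = assms(12) and \<phi> = assms(13) and f = assms(14)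
    and h = assms(15) and \<Omega> = assms(16) and base = assms(17) and F = assms(18) and flat = assms(19)
  define r where "r = sqrt (real m + k\<^sup>2 * (real n - 1))"
  \<comment> \<open>These bounds give r > k, so that N is positive for \<sigma> = 1 and negative for
    \<sigma> = -1.\<close>
  have "real n - 1 \<ge> 1" "real m \<ge> 1" using n m by simp_all
  then have "k\<^sup>2 * 1 \<le> k\<^sup>2 * (real n - 1)" by (intro mult_left_mono) auto
  with \<open>real m \<ge> 1\<close> have "k\<^sup>2 < real m + k\<^sup>2 * (real n - 1)" by linarith
  then have r: "r > k" "r\<^sup>2 = real m + k\<^sup>2 * (real n - 1)"
    unfolding r_def using zero_le_power2[of k] by (simp add: real_less_rsqrt, intro real_sqrt_pow2, linarith)
  have Nr: "N = - k + \<sigma> * r" using N by (simp add: r_def)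
  have N0: "N \<noteq> 0" using Nr \<sigma> r(1) pos(1) by auto
  have quad: "N\<^sup>2 + 2 * k * N = real CARD('m) + k\<^sup>2 * (real CARD('n) - 2)"
  proof -
    have "(N + k)\<^sup>2 = r\<^sup>2" using Nr \<sigma> by auto
    then show ?thesis unfolding r(2) n(1) m(1) by (simp add: power2_eq_square algebra_simps)
  qed
  have half: "\<Omega> = {x. N * (\<Sum>i\<in>UNIV. \<alpha> $ i * x $ i) + b > 0}" by (simp add: \<Omega> \<xi>)
  have half1: "\<Omega> = {x. (\<Sum>i\<in>UNIV. \<alpha> $ i * x $ i) > - b / (- k + r)}" if "\<sigma> = 1"
    using that r(1) unfolding half Nr by (auto simp: field_simps)
  \<comment> \<open>Here N is negative, and dividing by it reverses the inequality.\<close>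
  have half2: "\<Omega> = {x. (\<Sum>i\<in>UNIV. \<alpha> $ i * x $ i) < - b / (- k - r)}" if "\<sigma> = -1"
    using that r(1) pos(1) unfolding half Nr by (auto simp: field_simps)

  \<comment> \<open>Now u is \<open>L x + b\<close> with \<open>L\<close> linear, the form in which
    powers and logarithms are known to be smooth.\<close>
  define L where "L = (\<lambda>x. N * \<xi> x)"
  have L: "bounded_linear L"
    unfolding L_def \<xi> linear_conv_bounded_linear[symmetric]
    by (auto intro!: linearI simp: algebra_simps sum.distrib sum_distrib_left)
  have open_\<Omega>: "open \<Omega>" unfolding half by (intro open_Collect_less continuous_intros)
  have Lpos: "L x + b > 0" if "x \<in> \<Omega>" for x using that by (simp add: \<Omega> L_def)
  \<comment> \<open>\<open>A\<close> is \<phi>^-2 and \<open>B\<close> is f^2 in terms of u: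
    squaring doubles the exponents -k/N and -1/N, and the reciprocal changes the sign of the
    first.\<close>
  define A where "A = (\<lambda>u :: real. (1 / c\<^sub>2\<^sup>2) * u powr (2 * k / N))"
  define B where "B = (\<lambda>u :: real. c\<^sub>1\<^sup>2 * u powr (- 2 / N))"
  have A: "A u > 0" "(A has_real_derivative (2 * k / N) * A u / u) (at u)" if "u > 0" for u
  proof -
    show "A u > 0" using that pos by (simp add: A_def)
    have "(A has_real_derivative (1 / c\<^sub>2\<^sup>2) * ((2 * k / N) * u powr (2 * k / N - 1))) (at u)"
      unfolding A_def by (intro DERIV_cmult has_real_derivative_powr that)
    then show "(A has_real_derivative (2 * k / N) * A u / u) (at u)"
      using that by (simp add: A_def powr_diff ac_simps)
  qed
  have B: "B u > 0" "(B has_real_derivative (- 2 / N) * B u / u) (at u)" if "u > 0" for u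
  proof -
    show "B u > 0" using that pos by (simp add: B_def)
    have "(B has_real_derivative c\<^sub>1\<^sup>2 * ((- 2 / N) * u powr (- 2 / N - 1))) (at u)"
      unfolding B_def by (intro DERIV_cmult has_real_derivative_powr that)
    then show "(B has_real_derivative (- 2 / N) * B u / u) (at u)"
      using that by (simp add: B_def powr_diff ac_simps)
  qed
  have \<phi>A: "1 / (\<phi> (\<xi> x))\<^sup>2 = A (L x + b)" for x
  proof -
    have "((L x + b) powr (k / N))\<^sup>2 = (L x + b) powr (2 * k / N)"
      by (simp add: power2_eq_square flip: powr_add)
    then show ?thesis by (simp add: \<phi> A_def L_def power_divide)
  qed
  have fp: "f (\<xi> x) = c\<^sub>1 * (L x + b) powr (- 1 / N)" for x
    by (simp add: f L_def powr_minus_divide)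
  have fB: "(f (\<xi> x))\<^sup>2 = B (L x + b)" for x
  proof -
    have "((L x + b) powr (- 1 / N))\<^sup>2 = (L x + b) powr (- 2 / N)"
      by (simp add: power2_eq_square flip: powr_add)
    then show ?thesis by (simp add: fp B_def power_mult_distrib)
  qed

  have "smooth_on \<Omega> (\<lambda>x. 1 / (\<phi> (\<xi> x))\<^sup>2)"
    unfolding \<phi>A A_def
    by (intro smooth_on_bilinear[OF open_\<Omega> bounded_bilinear_mult] smooth_on_const[OF open_\<Omega>]
        smooth_on_powr[OF open_\<Omega> L Lpos])
  then have sbase: "semi_riemannian_manifold base"
    unfolding base using A(1)[OF Lpos]
    by (intro semi_riemannian_conformal_pseudo_euclidean open_\<Omega> \<epsilon>) (simp_all only: \<phi>A)
  have "smooth_on \<Omega> (\<lambda>x. f (\<xi> x))"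
    unfolding fp
    by (intro smooth_on_bilinear[OF open_\<Omega> bounded_bilinear_mult] smooth_on_const[OF open_\<Omega>]
        smooth_on_powr[OF open_\<Omega> L Lpos])
  moreover have "f (\<xi> x) > 0" if "x \<in> \<Omega>" for x
    using Lpos[OF that] pos by (simp add: fp)
  ultimately have warp: "warping_function base (\<lambda>x. f (\<xi> x))"
    unfolding warping_function_def base
    by (simp add: smooth_function_conformal_pseudo_euclidean[OF open_\<Omega>])
  have "smooth_on \<Omega> (\<lambda>x. h (\<xi> x))"
    unfolding h L_def[symmetric, THEN fun_cong]
    by (intro smooth_on_bilinear[OF open_\<Omega> bounded_bilinear_mult] smooth_on_const[OF open_\<Omega>]
        smooth_on_ln[OF open_\<Omega> L Lpos])
  then have smooth_h: "smooth_function base (\<lambda>x. h (\<xi> x))"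
    unfolding base by (rule smooth_function_conformal_pseudo_euclidean[OF open_\<Omega>])

  let ?W = "warped_product base (\<lambda>x. f (\<xi> x)) F"
  let ?h = "\<lambda>(x, q). h (\<xi> x)"
  note mB = semi_riemannian_manifoldD(1)[OF sbase] and mF = semi_riemannian_manifoldD(1)[OF F]
  have soliton: "ricci ?W ij p + hessian ?W ?h ij p = 0" if ijp: "ij \<in> atlas ?W" "p \<in> chart_dom ?W ij" for ij p
  proof -
    obtain i j x q where ij: "ij = (i, j)" "p = (x, q)" "i \<in> atlas base" "j \<in> atlas F" "x \<in> \<Omega>" "q \<in> chart_dom F j"
      using ijp by (cases p) (auto simp: base)
    note c = smooth_manifold_chart[OF mF ij(4)]
    define \<gamma> where "\<gamma> = metric F j \<circ> chart_inv F j"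
    \<comment> \<open>The single base chart is the identity, so only the fiber coordinates are
      pulled back.\<close>
    have inv: "chart_inv ?W ij y = (proj_left y, chart_inv F j (proj_right y))"
      if "proj_left y \<in> \<Omega>" "proj_right y \<in> chart_img F j" for y
      unfolding ij(1) by (subst warped_product_chart_inv[OF mB mF ij(3,4)]) (simp_all add: base that)
    \<comment> \<open>The normalisation of \<alpha> supplies \<open>\<epsilon> i\<^sub>0\<close> for
      \<open>E\<close>, and \<open>D\<close> becomes the image of the product chart.\<close>
    interpret warped_chart \<epsilon> \<alpha> k N b "\<epsilon> i\<^sub>0" A B \<gamma> "chart_img F j" \<Omega> "metric ?W ij \<circ> chart_inv ?W ij"
    proof
      show "\<epsilon> i * \<epsilon> i = 1" for i using \<epsilon>[of i] by auto
      show "smooth_on (chart_img F j) \<gamma>" unfolding \<gamma>_def by (rule semi_riemannian_manifoldD(2)[OF F ij(4)])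
      show "transpose (\<gamma> z) = \<gamma> z" if "z \<in> chart_img F j" for z
        unfolding \<gamma>_def using semi_riemannian_manifoldD(4)[OF F ij(4) c(6)[OF that]] by simp
      show "invertible (\<gamma> z)" if "z \<in> chart_img F j" for z
        unfolding \<gamma>_def using semi_riemannian_manifoldD(5)[OF F ij(4) c(6)[OF that]] by simp
      fix y assume y: "proj_left y \<in> \<Omega>" "proj_right y \<in> chart_img F j"
      have "N * (\<Sum>i\<in>UNIV. \<alpha> $ i * y $ Inl i) = L (proj_left y)" by (simp add: L_def \<xi>)
      then show "(metric ?W ij \<circ> chart_inv ?W ij) y =
          block_diag (A (N * (\<Sum>i\<in>UNIV. \<alpha> $ i * y $ Inl i) + b) *\<^sub>R diag_matrix \<epsilon>)
            (B (N * (\<Sum>i\<in>UNIV. \<alpha> $ i * y $ Inl i) + b) *\<^sub>R \<gamma> (proj_right y))"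
        using inv[OF y] by (simp add: ij(1) base \<phi>A fB \<gamma>_def)
    qed (use N0 A B unit c(2) half in auto)
    let ?y = "chart ?W ij p"
    have y: "?y = join_vec x (chart F j q)" by (simp add: ij base)
    have q: "chart F j q \<in> chart_img F j" using ij by (simp add: chart_img_def)
    have "ricci_coord \<gamma> (chart F j q) = 0"
      using flat ij by (simp add: ricci_flat_def ricci_def \<gamma>_def)
    then show ?thesis
      unfolding ricci_def hessian_def
    \<comment> \<open>\<open>refl\<close> sets \<open>H\<close> to m - (n - 2) k + N, the constant
      in the prefactor of the given potential.\<close>
    proof (intro ricci_plus_hessian[OF _ _ refl quad])
      show "?y \<in> join_set \<Omega> (chart_img F j)" using ij q by (simp add: y base)
      show "\<forall>y\<in>join_set \<Omega> (chart_img F j). (?h \<circ> chart_inv ?W ij) y =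
          - ((real CARD('m) - (real CARD('n) - 2) * k + N) / N) * ln (U y)"
        using inv by (simp add: h U_def \<xi> n m)
    qed (simp add: y)
  qed
  have "steady_gradient_ricci_soliton ?W ?h"
    unfolding steady_gradient_ricci_soliton_def
    using warped_product_semi_riemannian[OF sbase F warp]
      warped_product_smooth_function[OF mB mF smooth_h] soliton by blast
  with sbase warp half1 half2 show ?thesis unfolding r_def by blast
qed

end
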